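(* Let $m\ge 0$ be an integer, let $f\colon X\to Y$ be a continuous closed surjection, where $X$ is a $k$-space and $Y$ is a paracompact space with $\dim Y\le m$. Let $K$ be any space such that $K\in ANE(\mathbb{I}^m\times X)$ and $\operatorname{e-dim}(\mathbb{I}^m\times f^{-1}(y))\le K$ for every $y\in Y$. Then $\operatorname{e-dim} X\le K$.
   Context: All spaces are completely regular and all single-valued maps are continuous. $\mathbb{I}=[0,1]$ and $\dim$ is covering dimension. For spaces $K$ and $X$: $K\in AE(X)$ (respectively $K\in ANE(X)$) means that every continuous map $A\to K$ defined on a closed subset $A\subset X$ extends continuously to a map $X\to K$ (respectively to a map from some neighborhood of $A$ in $X$ into $K$). For a space $K$, the notation $\operatorname{e-dim} X\le K$ means $K\in AE(X)$. *)

theory Defs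
  imports "HOL-Analysis.Analysis"
begin

text \<open>
  Completely regular spaces are understood in the usual sense of dimension theory, i.e. with
  the \<open>T\<^sub>1\<close> axiom; \<^const>\<open>completely_regular_space\<close> does not include it.
\<close>

definition tychonoff_space :: "'a topology \<Rightarrow> bool" where
  "tychonoff_space X \<longleftrightarrow> t1_space X \<and> completely_regular_space X"

definition open_cover_of :: "'a topology \<Rightarrow> 'a set set \<Rightarrow> bool" where
  "open_cover_of X \<U> \<longleftrightarrow> (\<forall>U\<in>\<U>. openin X U) \<and> \<Union>\<U> = topspace X"

definition refines :: "'a set set \<Rightarrow> 'a set set \<Rightarrow> bool" where
  "refines \<V> \<U> \<longleftrightarrow> (\<forall>V\<in>\<V>. \<exists>U\<in>\<U>. V \<subseteq> U)"

text \<open>The Hausdorff axiom is not part of this definition.\<close>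

definition paracompact_space :: "'a topology \<Rightarrow> bool" where
  "paracompact_space X \<longleftrightarrow>
    (\<forall>\<U>. open_cover_of X \<U> \<longrightarrow>
      (\<exists>\<V>. open_cover_of X \<V> \<and> refines \<V> \<U> \<and> locally_finite_in X \<V>))"

text \<open>
  \<open>dim X \<le> n\<close>, for normal \<open>X\<close>: every finite open cover has a finite open refinement
  of order at most \<open>n\<close>, i.e. one in which each point lies in at most \<open>n + 1\<close> members.
\<close>

definition covering_dim_le :: "'a topology \<Rightarrow> nat \<Rightarrow> bool" where
  "covering_dim_le X n \<longleftrightarrow>
    (\<forall>\<U>. finite \<U> \<and> open_cover_of X \<U> \<longrightarrow>
      (\<exists>\<V>. finite \<V> \<and> open_cover_of X \<V> \<and> refines \<V> \<U> \<and>
        (\<forall>x\<in>topspace X. card {V\<in>\<V>. x \<in> V} \<le> n + 1)))"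

text \<open>\<open>K \<in> AE(X)\<close> and \<open>K \<in> ANE(X)\<close>.\<close>

definition absolute_extensor :: "'b topology \<Rightarrow> 'a topology \<Rightarrow> bool" where
  "absolute_extensor K X \<longleftrightarrow>
    (\<forall>A g. closedin X A \<and> continuous_map (subtopology X A) K g \<longrightarrow>
      (\<exists>h. continuous_map X K h \<and> (\<forall>x\<in>A. h x = g x)))"

definition absolute_neighborhood_extensor :: "'b topology \<Rightarrow> 'a topology \<Rightarrow> bool" where
  "absolute_neighborhood_extensor K X \<longleftrightarrow>
    (\<forall>A g. closedin X A \<and> continuous_map (subtopology X A) K g \<longrightarrow>
      (\<exists>U h. openin X U \<and> A \<subseteq> U \<and> continuous_map (subtopology X U) K h \<and>
        (\<forall>x\<in>A. h x = g x)))"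

definition e_dim_le :: "'a topology \<Rightarrow> 'b topology \<Rightarrow> bool" where
  "e_dim_le X K \<longleftrightarrow> absolute_extensor K X"

definition unit_cube :: "nat \<Rightarrow> (nat \<Rightarrow> real) topology" where
  "unit_cube m = product_topology (\<lambda>_. top_of_set {0..1}) {..<m}"

end

theory Submission
  imports Defs
begin

text \<open>
  Let \<open>g\<close> be a map on a closed \<open>A \<subseteq> X\<close> to be extended. Near each fibre \<open>g\<close> extends, and since
  \<open>K\<close> is an extensor for the product of the \<open>m\<close>-cube with each fibre, extensions near a fibre can
  be joined by homotopies relative to \<open>A\<close>, and these by homotopies parametrised by simplices of
  dimension up to \<open>m\<close>. By induction on the dimension one gets a locally finite cover of \<open>Y\<close> with
  a compatible family of extensions, parametrised by simplices, over the intersections of its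
  members. As \<open>dim Y \<le> m\<close>, the cover can be refined by \<open>m + 1\<close> families of pairwise disjoint
  open sets; a partition of unity \<open>t\<close> on \<open>Y\<close> subordinate to the unions of these families selects
  the point \<open>t (f x)\<close> of a simplex at which the extension over \<open>x\<close> is evaluated.
\<close>

section \<open>Paracompactness and covering dimension\<close>

text \<open>The obstacle is that \<open>K\<close> has no convex structure: local extensions cannot
  be averaged by a partition of unity, so a map on a whole simplex of parameters replaces the
  average. At most \<open>m + 1\<close> weights are needed, which is why the parameters fit in the
  \<open>m\<close>-cube. Every filling is made on the whole cube, with only its values on the faces
  prescribed, so the hypothesis on the \<open>m\<close>-cube serves in all dimensions up to
  \<open>m\<close>. A filling exists at first over one fibre only; the neighbourhood extension
  property thickens it, and since the projection to \<open>Y\<close> is closed, the thickening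
  contains the preimage of an open set. This set depends on the simplex, so the cover is refined at
  each dimension. Simplices are labelled by sets of colours and not by sets of cover members: the
  same colours then own the same face of the cube over all of \<open>Y\<close>, and refining may
  identify labels without collapsing the simplex.\<close>

lemma paracompact_regular_shrinking:
  assumes par: "paracompact_space Y" and reg: "regular_space Y"
    and U: "\<And>i. i \<in> I \<Longrightarrow> openin Y (U i)" and cov: "(\<Union>i\<in>I. U i) = topspace Y"
  obtains V where "\<And>i. i \<in> I \<Longrightarrow> openin Y (V i)"
    "\<And>i. i \<in> I \<Longrightarrow> Y closure_of (V i) \<subseteq> U i" "(\<Union>i\<in>I. V i) = topspace Y"
proof -
  define \<O> where "\<O> = {G. openin Y G \<and> (\<exists>i\<in>I. Y closure_of G \<subseteq> U i)}"
  have "open_cover_of Y \<O>"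
    unfolding open_cover_of_def
  proof (intro conjI ballI equalityI subsetI)
    fix y assume y: "y \<in> topspace Y"
    then obtain i where i: "i \<in> I" "y \<in> U i"
      using cov by blast
    then obtain G C where "openin Y G" "closedin Y C" "y \<in> G" "G \<subseteq> C" "C \<subseteq> U i"
      using reg U unfolding neighbourhood_base_of_closedin [symmetric] neighbourhood_base_of
      by meson
    then have "G \<in> \<O>"
      unfolding \<O>_def using i(1) closure_of_minimal by (metis (mono_tags, lifting) mem_Collect_eq order_trans)
    with \<open>y \<in> G\<close> show "y \<in> \<Union>\<O>" by blast
  qed (auto simp: \<O>_def dest: openin_subset)
  then obtain \<V> where \<V>: "open_cover_of Y \<V>" "refines \<V> \<O>" "locally_finite_in Y \<V>"
    using par unfolding paracompact_space_def by meson
  have "\<forall>G\<in>\<V>. \<exists>i\<in>I. Y closure_of G \<subseteq> U i"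
    using \<V>(2) unfolding refines_def \<O>_def by (smt (verit) closure_of_mono mem_Collect_eq order_trans)
  then obtain r where r: "\<And>G. G \<in> \<V> \<Longrightarrow> r G \<in> I" "\<And>G. G \<in> \<V> \<Longrightarrow> Y closure_of G \<subseteq> U (r G)"
    by metis
  show thesis
  proof
    fix i assume "i \<in> I"
    show "openin Y (\<Union>{G\<in>\<V>. r G = i})"
      using \<V>(1) unfolding open_cover_of_def by blast
    \<comment> \<open>Local finiteness lets the closure pass inside the union of all members
      assigned to \<open>i\<close>, however many there are.\<close>
    have "locally_finite_in Y {G\<in>\<V>. r G = i}"
      using \<V>(3) by (rule locally_finite_in_subset) auto
    then have "Y closure_of \<Union>{G\<in>\<V>. r G = i} = \<Union>((\<lambda>S. Y closure_of S) ` {G\<in>\<V>. r G = i})"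
      by (rule closure_of_locally_finite_Union)
    also have "\<dots> \<subseteq> U i" using r by blast
    finally show "Y closure_of \<Union>{G\<in>\<V>. r G = i} \<subseteq> U i" .
  next
    show "(\<Union>i\<in>I. \<Union>{G\<in>\<V>. r G = i}) = topspace Y"
      using \<V>(1) r(1) unfolding open_cover_of_def by blast
  qed
qed

text \<open>Shrinking the cover by the complements of \<open>S\<close> and \<open>T\<close> leaves
  two closed sets that still cover, one missing \<open>S\<close> and the other \<open>T\<close>;
  their complements separate.\<close>

lemma paracompact_regular_imp_normal:
  assumes par: "paracompact_space Y" and reg: "regular_space Y"
  shows "normal_space Y"
  unfolding normal_space_def
proof (intro allI impI, elim conjE)
  fix S T assume S: "closedin Y S" and T: "closedin Y T" and d: "disjnt S T"
  let ?U = "\<lambda>b. topspace Y - (if b then S else T)"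
  obtain V where V: "\<And>i. i \<in> UNIV \<Longrightarrow> openin Y (V i)"
    "\<And>i. i \<in> UNIV \<Longrightarrow> Y closure_of (V i) \<subseteq> ?U i" "(\<Union>i\<in>UNIV. V i) = topspace Y"
  proof (rule paracompact_regular_shrinking [OF par reg, of UNIV ?U])
    show "openin Y (?U i)" for i using S T by auto
    show "(\<Union>i. ?U i) = topspace Y"
      using d unfolding disjnt_def by (auto simp: UNIV_bool)
  qed blast
  have sub: "V i \<subseteq> Y closure_of (V i)" for i
    using V(1) by (simp add: closure_of_subset openin_subset)
  show "\<exists>U V. openin Y U \<and> openin Y V \<and> S \<subseteq> U \<and> T \<subseteq> V \<and> disjnt U V"
  proof (intro exI conjI)
    show "openin Y (topspace Y - Y closure_of V True)" "openin Y (topspace Y - Y closure_of V False)"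
      by auto
    show "S \<subseteq> topspace Y - Y closure_of V True" "T \<subseteq> topspace Y - Y closure_of V False"
      using V(2)[of True] V(2)[of False] closedin_subset[OF S] closedin_subset[OF T] by auto
    show "disjnt (topspace Y - Y closure_of V True) (topspace Y - Y closure_of V False)"
      using V(3) sub unfolding disjnt_def UNIV_bool by blast
  qed
qed

section \<open>Covers of bounded order\<close>

lemma covering_dim_le_shrinking_empty_Inter:
  assumes dim: "covering_dim_le Y m" and T: "finite T" "card T > m + 1"
    and G: "\<And>t. t \<in> T \<Longrightarrow> openin Y (G t)" "(\<Union>t\<in>T. G t) = topspace Y"
  obtains V where "\<And>t. t \<in> T \<Longrightarrow> openin Y (V t)" "\<And>t. t \<in> T \<Longrightarrow> V t \<subseteq> G t"
    "(\<Union>t\<in>T. V t) = topspace Y" "(\<Inter>t\<in>T. V t) = {}"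
proof -
  have "finite (G ` T)" "open_cover_of Y (G ` T)"
    using T G unfolding open_cover_of_def by auto
  then obtain \<V> where \<V>: "finite \<V>" "open_cover_of Y \<V>" "refines \<V> (G ` T)"
    "\<And>y. y \<in> topspace Y \<Longrightarrow> card {V\<in>\<V>. y \<in> V} \<le> m + 1"
    using dim unfolding covering_dim_le_def by meson
  have "\<forall>V\<in>\<V>. \<exists>t\<in>T. V \<subseteq> G t"
    using \<V>(3) unfolding refines_def by blast
  then obtain r where r: "\<And>V. V \<in> \<V> \<Longrightarrow> r V \<in> T" "\<And>V. V \<in> \<V> \<Longrightarrow> V \<subseteq> G (r V)"
    by metis
  \<comment> \<open>Members of the refinement are amalgamated by the index of a \<open>G t\<close>
    containing them. A point common to all amalgams would lie in \<open>card T\<close> different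
    members, one for each index.\<close>
  let ?V = "\<lambda>t. \<Union>{V\<in>\<V>. r V = t}"
  show thesis
  proof
    show "openin Y (?V t)" for t using \<V>(2) unfolding open_cover_of_def by blast
    show "?V t \<subseteq> G t" for t using r(2) by blast
    show cov: "(\<Union>t\<in>T. ?V t) = topspace Y"
      using \<V>(2) r(1) unfolding open_cover_of_def by blast
    show "(\<Inter>t\<in>T. ?V t) = {}"
    proof (rule ccontr)
      assume "(\<Inter>t\<in>T. ?V t) \<noteq> {}"
      then obtain y where y: "\<And>t. t \<in> T \<Longrightarrow> y \<in> ?V t" by blast
      have "T \<noteq> {}" using T by auto
      then have "y \<in> topspace Y" using y cov by blast
      have "T \<subseteq> r ` {V\<in>\<V>. y \<in> V}" using y by blast
      then have "card T \<le> card {V\<in>\<V>. y \<in> V}"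
        using \<V>(1) by (metis (no_types, lifting) finite_subset mem_Collect_eq subsetI surj_card_le)
      with \<V>(4)[OF \<open>y \<in> topspace Y\<close>] T(2) show False by linarith
    qed
  qed
qed

text \<open>
  Dowker: the bound on the order passes from finite covers to locally finite ones. The
  \<open>(m + 2)\<close>-element subfamilies \<open>T\<close> are treated one at a time, by Zorn's lemma. Treating \<open>T\<close>
  removes a closed set \<open>R t\<close> from each \<open>t \<in> T\<close>, always inside the intersection of the closures of
  the members of \<open>T\<close>; as these intersections form a locally finite family, arbitrarily many
  removals still leave open sets, and near a given point only finitely many of them matter.
\<close>

lemma locally_finite_cover_shrinking_order:
  fixes Y :: "'b topology"
  assumes dim: "covering_dim_le Y m" and cov: "open_cover_of Y \<W>" and lf: "locally_finite_in Y \<W>"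
  obtains V where "\<And>W. W \<in> \<W> \<Longrightarrow> openin Y (V W)" "\<And>W. W \<in> \<W> \<Longrightarrow> V W \<subseteq> W"
    "(\<Union>W\<in>\<W>. V W) = topspace Y" "\<And>y. card {W\<in>\<W>. y \<in> V W} \<le> m + 1"
proof -
  define \<T> where "\<T> = {T. T \<subseteq> \<W> \<and> card T = m + 2}"
  define P where "P = (\<lambda>T. \<Inter>t\<in>T. Y closure_of t)"
  \<comment> \<open>\<open>E\<close> is a record of the subfamilies already treated: a pair
    \<open>(T,R)\<close> says that \<open>R W\<close> was removed from \<open>W\<close> when
    \<open>T\<close> was treated. \<open>V E W\<close> is what is left.\<close>
  define V where "V = (\<lambda>(E :: ('b set set \<times> ('b set \<Rightarrow> 'b set)) set) W. W - (\<Union>(T,R)\<in>E. R W))"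
  have finT: "finite T" "T \<noteq> {}" if "T \<in> \<T>" for T
    using that unfolding \<T>_def by (auto intro: card_ge_0_finite)
  have openW: "openin Y W" if "W \<in> \<W>" for W
    using cov that unfolding open_cover_of_def by blast
  have closedP: "closedin Y (P T)" if "T \<in> \<T>" for T
    unfolding P_def using finT[OF that] by (intro closedin_INT) auto
  have locP: "\<exists>N. openin Y N \<and> y \<in> N \<and> finite {T\<in>\<T>. P T \<inter> N \<noteq> {}}"
    if y: "y \<in> topspace Y" for y
  proof -
    obtain N where N: "openin Y N" "y \<in> N" "finite {W\<in>\<W>. W \<inter> N \<noteq> {}}"
      using lf y unfolding locally_finite_in_def by blast
    have "{T\<in>\<T>. P T \<inter> N \<noteq> {}} \<subseteq> Pow {W\<in>\<W>. W \<inter> N \<noteq> {}}"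
    proof (intro subsetI PowI CollectI)
      fix T W assume "T \<in> {T\<in>\<T>. P T \<inter> N \<noteq> {}}" "W \<in> T"
      then obtain z where T: "T \<in> \<T>" "z \<in> P T" "z \<in> N" "W \<in> T" by blast
      then have "z \<in> Y closure_of W" unfolding P_def by blast
      then have "W \<inter> N \<noteq> {}"
        using N(1) T(3) by (auto simp: in_closure_of)
      then show "W \<in> \<W> \<and> W \<inter> N \<noteq> {}"
        using T unfolding \<T>_def by blast
    qed
    then have "finite {T\<in>\<T>. P T \<inter> N \<noteq> {}}"
      using N(3) by (meson finite_Pow_iff finite_subset)
    with N show ?thesis by blast
  qed
  \<comment> \<open>Ordering the records by inclusion, instead of the shrunken covers, gives unions
    as upper bounds of chains. Single-valuedness means that each \<open>T\<close> is treated once,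
    which keeps the removals near a point finite in number.\<close>
  define \<E> where "\<E> = {E. single_valued E \<and>
      (\<forall>(T,R)\<in>E. T \<in> \<T> \<and> (\<forall>W. closedin Y (R W) \<and> R W \<subseteq> P T) \<and> (\<Inter>t\<in>T. V E t) = {}) \<and>
      (\<Union>W\<in>\<W>. V E W) = topspace Y}"
  have fin_rel: "finite {(T,R)\<in>E. P T \<inter> N \<noteq> {}}"
    if "single_valued E" "\<And>T R. (T,R) \<in> E \<Longrightarrow> T \<in> \<T>" "finite {T\<in>\<T>. P T \<inter> N \<noteq> {}}" for E N
  proof -
    have "inj_on fst {(T,R)\<in>E. P T \<inter> N \<noteq> {}}"
      using that(1) unfolding single_valued_def inj_on_def by auto
    moreover have "fst ` {(T,R)\<in>E. P T \<inter> N \<noteq> {}} \<subseteq> {T\<in>\<T>. P T \<inter> N \<noteq> {}}"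
      using that(2) by auto
    ultimately show ?thesis
      using that(3) by (meson finite_imageD finite_subset)
  qed
  have openV: "openin Y (V E W)"
    if E: "single_valued E" "\<And>T R. (T,R) \<in> E \<Longrightarrow> T \<in> \<T> \<and> closedin Y (R W) \<and> R W \<subseteq> P T"
      and W: "W \<in> \<W>" for E W
  proof -
    have "locally_finite_in Y ((\<lambda>(T,R). R W) ` E)"
      unfolding locally_finite_in_def
    proof (intro conjI ballI)
      show "\<Union>((\<lambda>(T,R). R W) ` E) \<subseteq> topspace Y"
        using E(2) closedin_subset by fastforce
      fix y assume "y \<in> topspace Y"
      then obtain N where N: "openin Y N" "y \<in> N" "finite {T\<in>\<T>. P T \<inter> N \<noteq> {}}"
        using locP by blast
      have "{U \<in> (\<lambda>(T,R). R W) ` E. U \<inter> N \<noteq> {}} \<subseteq> (\<lambda>(T,R). R W) ` {(T,R)\<in>E. P T \<inter> N \<noteq> {}}"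
        using E(2) by fastforce
      moreover have "finite {(T,R)\<in>E. P T \<inter> N \<noteq> {}}"
        using E N(3) by (intro fin_rel) auto
      ultimately have "finite {U \<in> (\<lambda>(T,R). R W) ` E. U \<inter> N \<noteq> {}}"
        by (meson finite_imageI finite_subset)
      with N show "\<exists>N. openin Y N \<and> y \<in> N \<and> finite {U \<in> (\<lambda>(T,R). R W) ` E. U \<inter> N \<noteq> {}}"
        by blast
    qed
    then have "closedin Y (\<Union>((\<lambda>(T,R). R W) ` E))"
      using E(2) by (intro closedin_locally_finite_Union) auto
    then show ?thesis
      unfolding V_def using openW[OF W] by blast
  qed
  have antimono: "V E' W \<subseteq> V E W" if "E \<subseteq> E'" for E E' W
    using that unfolding V_def by blast
  have "\<exists>E\<in>\<E>. \<forall>E'\<in>\<E>. E \<subseteq> E' \<longrightarrow> E' = E"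
  proof (rule subset_Zorn_nonempty)
    have "{} \<in> \<E>"
      using cov unfolding \<E>_def V_def open_cover_of_def by simp
    then show "\<E> \<noteq> {}" by blast
    fix \<C> assume ne: "\<C> \<noteq> {}" and ch: "subset.chain \<E> \<C>"
    then have \<C>: "E \<in> \<E>" if "E \<in> \<C>" for E
      using that unfolding subset.chain_def by blast
    have lin: "E \<subseteq> E' \<or> E' \<subseteq> E" if "E \<in> \<C>" "E' \<in> \<C>" for E E'
      using that ch unfolding subset.chain_def by blast
    have sv: "single_valued (\<Union>\<C>)"
      unfolding single_valued_def
    proof clarify
      fix T R R' E E' assume "E \<in> \<C>" "E' \<in> \<C>" "(T,R) \<in> E" "(T,R') \<in> E'"
      then obtain E'' where "E'' \<in> \<C>" "(T,R) \<in> E''" "(T,R') \<in> E''"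
        using lin by blast
      then show "R = R'"
        using \<C>[of E''] unfolding \<E>_def single_valued_def by blast
    qed
    have mem: "T \<in> \<T> \<and> (\<forall>W. closedin Y (R W) \<and> R W \<subseteq> P T) \<and> (\<Inter>t\<in>T. V (\<Union>\<C>) t) = {}"
      if "(T,R) \<in> \<Union>\<C>" for T R
    proof -
      from that obtain E where E: "E \<in> \<C>" "(T,R) \<in> E" by blast
      then have *: "T \<in> \<T> \<and> (\<forall>W. closedin Y (R W) \<and> R W \<subseteq> P T) \<and> (\<Inter>t\<in>T. V E t) = {}"
        using \<C>[OF E(1)] unfolding \<E>_def by blast
      moreover have "(\<Inter>t\<in>T. V (\<Union>\<C>) t) \<subseteq> (\<Inter>t\<in>T. V E t)"
        using antimono[of E "\<Union>\<C>"] E(1) by blast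
      ultimately show ?thesis by blast
    qed
    have "y \<in> (\<Union>W\<in>\<W>. V (\<Union>\<C>) W)" if y: "y \<in> topspace Y" for y
    proof -
      obtain N where N: "openin Y N" "y \<in> N" "finite {T\<in>\<T>. P T \<inter> N \<noteq> {}}"
        using locP y by blast
      have "finite {(T,R)\<in>\<Union>\<C>. P T \<inter> N \<noteq> {}}"
        using fin_rel[OF sv _ N(3)] mem by blast
      moreover have "{(T,R)\<in>\<Union>\<C>. P T \<inter> N \<noteq> {}} \<subseteq> \<Union>\<C>" by blast
      \<comment> \<open>Only finitely many removals can reach \<open>y\<close>, and one member
        \<open>E\<close> of the chain contains all of them; so the covering property at
        \<open>y\<close> is inherited from \<open>E\<close>.\<close>
      ultimately obtain E where E: "E \<in> \<C>" "{(T,R)\<in>\<Union>\<C>. P T \<inter> N \<noteq> {}} \<subseteq> E"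
        by (rule finite_subset_Union_chain[OF _ _ ne ch]) blast
      then obtain W where W: "W \<in> \<W>" "y \<in> V E W"
        using \<C>[OF E(1)] y unfolding \<E>_def by blast
      have "y \<in> V (\<Union>\<C>) W"
        unfolding V_def
      proof (intro DiffI notI)
        show "y \<in> W" using W unfolding V_def by blast
        assume "y \<in> (\<Union>(T,R)\<in>\<Union>\<C>. R W)"
        then obtain T R where TR: "(T,R) \<in> \<Union>\<C>" "y \<in> R W" by blast
        then have "y \<in> P T" using mem[OF TR(1)] by blast
        then have "(T,R) \<in> E" using E(2) TR(1) N(2) by blast
        then show False using W(2) TR(2) unfolding V_def by blast
      qed
      with W show ?thesis by blast
    qed
    moreover have "(\<Union>W\<in>\<W>. V (\<Union>\<C>) W) \<subseteq> topspace Y"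
      using openW openin_subset unfolding V_def by fastforce
    ultimately have "(\<Union>W\<in>\<W>. V (\<Union>\<C>) W) = topspace Y" by blast
    moreover have "\<forall>(T,R)\<in>\<Union>\<C>. T \<in> \<T> \<and> (\<forall>W. closedin Y (R W) \<and> R W \<subseteq> P T) \<and>
        (\<Inter>t\<in>T. V (\<Union>\<C>) t) = {}"
      by (rule ballI, rule case_prodI2, rule mem) simp
    ultimately show "\<Union>\<C> \<in> \<E>"
      using sv unfolding \<E>_def by blast
  qed
  then obtain E where E: "E \<in> \<E>" and max: "\<And>E'. E' \<in> \<E> \<Longrightarrow> E \<subseteq> E' \<Longrightarrow> E' = E"
    by blast
  have Esv: "single_valued E" and Ecov: "(\<Union>W\<in>\<W>. V E W) = topspace Y"
    using E unfolding \<E>_def by blast+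
  have Emem: "T \<in> \<T> \<and> (\<forall>W. closedin Y (R W) \<and> R W \<subseteq> P T) \<and> (\<Inter>t\<in>T. V E t) = {}"
    if "(T,R) \<in> E" for T R
    using E that unfolding \<E>_def by blast
  have Eopen: "openin Y (V E W)" if "W \<in> \<W>" for W
    using openV[OF Esv _ that] Emem by blast
  have dom: "T \<in> Domain E" if T: "T \<in> \<T>" for T
  proof (rule ccontr)
    assume nd: "T \<notin> Domain E"
    obtain t0 where t0: "t0 \<in> T" using finT[OF T] by blast
    have TW: "T \<subseteq> \<W>" using T unfolding \<T>_def by blast
    \<comment> \<open>The auxiliary cover must be indexed by \<open>T\<close> alone. The remaining
      members, and everything outside \<open>P T\<close>, where nothing will be removed, are
      therefore assigned to the single index \<open>t0\<close>.\<close>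
    define G where "G = (\<lambda>t. if t = t0
        then V E t0 \<union> (\<Union>W\<in>\<W> - T. V E W) \<union> (topspace Y - P T) else V E t)"
    obtain V' where V': "\<And>t. t \<in> T \<Longrightarrow> openin Y (V' t)" "\<And>t. t \<in> T \<Longrightarrow> V' t \<subseteq> G t"
      "(\<Union>t\<in>T. V' t) = topspace Y" "(\<Inter>t\<in>T. V' t) = {}"
    proof (rule covering_dim_le_shrinking_empty_Inter[OF dim, of T G])
      show "finite T" using finT[OF T] by blast
      show "m + 1 < card T" using T unfolding \<T>_def by simp
      show "openin Y (G t)" if "t \<in> T" for t
        unfolding G_def using that TW t0 Eopen closedP[OF T]
        by (auto intro!: openin_Un openin_Union)
      have "(\<Union>t\<in>T. G t) \<subseteq> topspace Y"
        using TW Ecov t0 unfolding G_def by (auto split: if_splits)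
      moreover have "topspace Y \<subseteq> (\<Union>t\<in>T. G t)"
      proof
        fix y assume "y \<in> topspace Y"
        then obtain W where "W \<in> \<W>" "y \<in> V E W" using Ecov by blast
        then show "y \<in> (\<Union>t\<in>T. G t)"
          using t0 unfolding G_def by (cases "W \<in> T"; cases "W = t0") (auto split: if_splits)
      qed
      ultimately show "(\<Union>t\<in>T. G t) = topspace Y" by blast
    qed blast
    \<comment> \<open>Inside \<open>P T\<close> the set \<open>V E t\<close> is cut down to its part
      in \<open>V' t\<close>; outside nothing changes. That is enough, since the intersection of the
      \<open>V E t\<close> over \<open>T\<close> lies in \<open>P T\<close> anyway.\<close>
    define R where "R = (\<lambda>W. if W \<in> T then P T - V' W else {})"
    define E' where "E' = insert (T,R) E"
    have VE': "V E' W = V E W - R W" for W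
      unfolding V_def E'_def by blast
    have "E' \<in> \<E>"
      unfolding \<E>_def
    proof (intro CollectI conjI)
      show "single_valued E'"
        using Esv nd unfolding E'_def single_valued_def by blast
      have R: "closedin Y (R W) \<and> R W \<subseteq> P T" for W
        using V'(1) closedP[OF T] unfolding R_def by (auto intro: closedin_diff)
      have removed: "(\<Inter>t\<in>T. V E' t) = {}"
      proof (rule ccontr)
        assume "(\<Inter>t\<in>T. V E' t) \<noteq> {}"
        then obtain y where y: "\<And>t. t \<in> T \<Longrightarrow> y \<in> V E t - R t" unfolding VE' by blast
        have "y \<in> Y closure_of t" if "t \<in> T" for t
        proof -
          have "y \<in> t" using y[OF that] unfolding V_def by blast
          moreover have "t \<subseteq> topspace Y" using openW openin_subset TW that by blast
          ultimately show ?thesis using closure_of_subset by blast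
        qed
        then have "y \<in> P T" unfolding P_def by blast
        then have "y \<in> V' t" if "t \<in> T" for t
          using y[OF that] that unfolding R_def by simp
        then show False using V'(4) by blast
      qed
      have kept: "(\<Inter>t\<in>T'. V E' t) = {}" if "(T',R') \<in> E" for T' R'
      proof -
        have "(\<Inter>t\<in>T'. V E' t) \<subseteq> (\<Inter>t\<in>T'. V E t)" unfolding VE' by blast
        then show ?thesis using Emem[OF that] by blast
      qed
      have "T' \<in> \<T> \<and> (\<forall>W. closedin Y (R' W) \<and> R' W \<subseteq> P T') \<and> (\<Inter>t\<in>T'. V E' t) = {}"
        if "(T',R') \<in> E'" for T' R'
      proof (cases "(T',R') \<in> E")
        case True
        then show ?thesis using Emem[OF True] kept[OF True] by blast
      next
        case False
        then have "T' = T" "R' = R" using that unfolding E'_def by auto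
        then show ?thesis using T R removed by blast
      qed
      then show "\<forall>(T,R)\<in>E'. T \<in> \<T> \<and> (\<forall>W. closedin Y (R W) \<and> R W \<subseteq> P T) \<and> (\<Inter>t\<in>T. V E' t) = {}"
        by blast
      have "y \<in> (\<Union>W\<in>\<W>. V E' W)" if y: "y \<in> topspace Y" for y
      proof (cases "y \<in> P T")
        case False
        then show ?thesis
          using y Ecov unfolding VE' R_def by force
      next
        case True
        obtain t where t: "t \<in> T" "y \<in> V' t" using V'(3) y by blast
        then have "y \<in> G t" using V'(2) by blast
        show ?thesis
        proof (cases "y \<in> V E t")
          case True
          then have "y \<in> V E' t" using t unfolding VE' R_def by simp
          then show ?thesis using t TW by blast
        next
          case False
          with \<open>y \<in> G t\<close> \<open>y \<in> P T\<close> obtain W where "W \<in> \<W> - T" "y \<in> V E W"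
            unfolding G_def by (auto split: if_splits)
          then show ?thesis unfolding VE' R_def by auto
        qed
      qed
      moreover have "(\<Union>W\<in>\<W>. V E' W) \<subseteq> topspace Y"
        using Ecov unfolding VE' by blast
      ultimately show "(\<Union>W\<in>\<W>. V E' W) = topspace Y" by blast
    qed
    then have "E' = E" using max unfolding E'_def by blast
    then show False using nd unfolding E'_def by blast
  qed
  show thesis
  proof
    show "openin Y (V E W)" if "W \<in> \<W>" for W using Eopen that .
    show "V E W \<subseteq> W" for W unfolding V_def by blast
    show "(\<Union>W\<in>\<W>. V E W) = topspace Y" by (rule Ecov)
    show "card {W\<in>\<W>. y \<in> V E W} \<le> m + 1" for y
    proof (rule ccontr)
      assume "\<not> card {W\<in>\<W>. y \<in> V E W} \<le> m + 1"
      then have "m + 2 \<le> card {W\<in>\<W>. y \<in> V E W}" by simp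
      then obtain T where T: "T \<subseteq> {W\<in>\<W>. y \<in> V E W}" "card T = m + 2"
        by (meson obtain_subset_with_card_n)
      then have "T \<in> \<T>" unfolding \<T>_def by blast
      then have "(\<Inter>t\<in>T. V E t) = {}" using dom Emem by blast
      then show False using T by blast
    qed
  qed
qed

section \<open>Partitions of unity and colourings\<close>

lemma subordinate_functions:
  assumes par: "paracompact_space Y" and reg: "regular_space Y"
    and U: "\<And>i. i \<in> I \<Longrightarrow> openin Y (U i)" "(\<Union>i\<in>I. U i) = topspace Y"
  obtains l :: "'i \<Rightarrow> 'b \<Rightarrow> real" where "\<And>i. i \<in> I \<Longrightarrow> continuous_map Y euclideanreal (l i)"
    "\<And>i y. i \<in> I \<Longrightarrow> y \<in> topspace Y \<Longrightarrow> 0 \<le> l i y"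
    "\<And>y. y \<in> topspace Y \<Longrightarrow> \<exists>i\<in>I. 0 < l i y"
    "\<And>i y. i \<in> I \<Longrightarrow> y \<in> topspace Y - U i \<Longrightarrow> \<exists>N. openin Y N \<and> y \<in> N \<and> (\<forall>z\<in>N. l i z = 0)"
proof -
  obtain V where V: "\<And>i. i \<in> I \<Longrightarrow> openin Y (V i)"
    "\<And>i. i \<in> I \<Longrightarrow> Y closure_of (V i) \<subseteq> U i" "(\<Union>i\<in>I. V i) = topspace Y"
    using paracompact_regular_shrinking[OF par reg U] by blast
  \<comment> \<open>The second shrinking leaves room: the functions vanish off \<open>V i\<close>,
    whose closure lies in \<open>U i\<close>. Hence they vanish near each point outside
    \<open>U i\<close>, not merely at it.\<close>
  obtain V' where V': "\<And>i. i \<in> I \<Longrightarrow> openin Y (V' i)"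
    "\<And>i. i \<in> I \<Longrightarrow> Y closure_of (V' i) \<subseteq> V i" "(\<Union>i\<in>I. V' i) = topspace Y"
    using paracompact_regular_shrinking[OF par reg V(1,3)] by blast
  have "\<forall>i\<in>I. \<exists>l. continuous_map Y (top_of_set {0..1::real}) l \<and>
     l ` (topspace Y - V i) \<subseteq> {0} \<and> l ` (Y closure_of V' i) \<subseteq> {1}"
  proof
    fix i assume i: "i \<in> I"
    show "\<exists>l. continuous_map Y (top_of_set {0..1::real}) l \<and>
     l ` (topspace Y - V i) \<subseteq> {0} \<and> l ` (Y closure_of V' i) \<subseteq> {1}"
      by (rule Urysohn_lemma[OF paracompact_regular_imp_normal[OF par reg], of "topspace Y - V i" "Y closure_of V' i" 0 1])
         (use V(1)[OF i] V'(2)[OF i] in \<open>auto simp: disjnt_def\<close>)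
  qed
  then obtain l where l: "\<And>i. i \<in> I \<Longrightarrow> continuous_map Y (top_of_set {0..1::real}) (l i)"
    "\<And>i. i \<in> I \<Longrightarrow> l i ` (topspace Y - V i) \<subseteq> {0}"
    "\<And>i. i \<in> I \<Longrightarrow> l i ` (Y closure_of V' i) \<subseteq> {1}"
    by metis
  show thesis
  proof
    show "continuous_map Y euclideanreal (l i)" if "i \<in> I" for i
      using l(1)[OF that] continuous_map_in_subtopology by blast
    show "0 \<le> l i y" if "i \<in> I" "y \<in> topspace Y" for i y
      using l(1)[OF that(1)] that(2) by (auto simp: continuous_map_def Pi_iff)
    show "\<exists>i\<in>I. 0 < l i y" if y: "y \<in> topspace Y" for y
    proof -
      obtain i where i: "i \<in> I" "y \<in> V' i" using V'(3) y by blast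
      then have "y \<in> Y closure_of V' i"
        using closure_of_subset[OF openin_subset[OF V'(1)[OF i(1)]]] by blast
      then have "l i y = 1" using l(3)[OF i(1)] by blast
      with i(1) show ?thesis by force
    qed
    fix i y assume i: "i \<in> I" and y: "y \<in> topspace Y - U i"
    show "\<exists>N. openin Y N \<and> y \<in> N \<and> (\<forall>z\<in>N. l i z = 0)"
    proof (intro exI conjI ballI)
      show "openin Y (topspace Y - Y closure_of V i)" by auto
      show "y \<in> topspace Y - Y closure_of V i" using y V(2)[OF i] by blast
      fix z assume "z \<in> topspace Y - Y closure_of V i"
      then have "z \<in> topspace Y - V i"
        using closure_of_subset[OF openin_subset[OF V(1)[OF i]]] by blast
      then show "l i z = 0" using l(2)[OF i] by blast
    qed
  qed
qed

text \<open>
  The colouring is that of the barycentric subdivision of a nerve: the vertex \<open>\<sigma>\<close> of the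
  subdivision has colour \<open>card \<sigma> - 1\<close>, and its open star pulls back to \<open>G \<sigma>\<close>.
\<close>

lemma covering_dim_le_colouring:
  fixes Y :: "'b topology"
  assumes par: "paracompact_space Y" and reg: "regular_space Y" and dim: "covering_dim_le Y m"
    and cov: "open_cover_of Y \<W>" and lf: "locally_finite_in Y \<W>"
  obtains Q :: "nat \<Rightarrow> 'b set" and w :: "nat \<Rightarrow> 'b \<Rightarrow> 'b set"
  where "\<And>i. openin Y (Q i)" "(\<Union>i\<le>m. Q i) = topspace Y" "\<And>i y. y \<in> Q i \<Longrightarrow> w i y \<in> \<W>"
    "\<And>i y. y \<in> Q i \<Longrightarrow> \<exists>N. openin Y N \<and> y \<in> N \<and> N \<subseteq> Q i \<and> N \<subseteq> w i y \<and> (\<forall>z\<in>N. w i z = w i y)"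
proof -
  obtain V where V: "\<And>W. W \<in> \<W> \<Longrightarrow> openin Y (V W)" "\<And>W. W \<in> \<W> \<Longrightarrow> V W \<subseteq> W"
    "(\<Union>W\<in>\<W>. V W) = topspace Y" "\<And>y. card {W\<in>\<W>. y \<in> V W} \<le> m + 1"
    using locally_finite_cover_shrinking_order[OF dim cov lf] by blast
  obtain l :: "'b set \<Rightarrow> 'b \<Rightarrow> real" where contl: "\<And>W. W \<in> \<W> \<Longrightarrow> continuous_map Y euclideanreal (l W)"
    and l_ge: "\<And>W y. W \<in> \<W> \<Longrightarrow> y \<in> topspace Y \<Longrightarrow> 0 \<le> l W y"
    and l_ex: "\<And>y. y \<in> topspace Y \<Longrightarrow> \<exists>W\<in>\<W>. 0 < l W y"
    and l_loc: "\<And>W y. W \<in> \<W> \<Longrightarrow> y \<in> topspace Y - V W \<Longrightarrow>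
      \<exists>N. openin Y N \<and> y \<in> N \<and> (\<forall>z\<in>N. l W z = 0)"
    apply (rule subordinate_functions[OF par reg V(1,3)], assumption)
    subgoal premises prems for l by (rule prems(1)[OF prems(2-5)])
    done
  have l_zero: "l W y = 0" if "W \<in> \<W>" "y \<in> topspace Y - V W" for W y
    using l_loc[OF that] by blast
  have l_pos: "y \<in> V W" if "W \<in> \<W>" "y \<in> topspace Y" "l W y > 0" for W y
    using l_zero[of W y] that by fastforce
  \<comment> \<open>With \<open>l\<close> read as unnormalised barycentric coordinates,
    \<open>\<sigma>\<close> collects the largest ones, strictly separated from the rest. The strict
    gap makes sets of equal size exclude each other.\<close>
  define G where "G = (\<lambda>\<sigma>. {y \<in> topspace Y. (\<forall>s\<in>\<sigma>. l s y > 0) \<and> (\<forall>s\<in>\<sigma>. \<forall>s'\<in>\<W> - \<sigma>. l s' y < l s y)})"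
  define C where "C = (\<lambda>i. {\<sigma>. \<sigma> \<subseteq> \<W> \<and> card \<sigma> = Suc i})"
  have C_fin: "finite \<sigma> \<and> \<sigma> \<noteq> {} \<and> \<sigma> \<subseteq> \<W>" if "\<sigma> \<in> C i" for \<sigma> i
    using that card_gt_0_iff[of \<sigma>] unfolding C_def by auto
  have G_open: "openin Y (G \<sigma>)" if \<sigma>: "\<sigma> \<in> C i" for \<sigma> i
  proof (subst openin_subopen, intro ballI)
    fix y assume y: "y \<in> G \<sigma>"
    then have "y \<in> topspace Y" unfolding G_def by blast
    then obtain M where M: "openin Y M" "y \<in> M" "finite {W\<in>\<W>. W \<inter> M \<noteq> {}}"
      using lf unfolding locally_finite_in_def by blast
    \<comment> \<open>The condition may compare with infinitely many functions; those of members
      missing \<open>M\<close> vanish on \<open>M\<close>, so only the finitely many in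
      \<open>?F\<close> restrict a neighbourhood of \<open>y\<close>.\<close>
    let ?F = "{W\<in>\<W>. W \<inter> M \<noteq> {}} - \<sigma>"
    define L where "L = M \<inter> (\<Inter>s\<in>\<sigma>. {z \<in> topspace Y. 0 < l s z} \<inter> ((\<Inter>s'\<in>?F. {z \<in> topspace Y. l s' z < l s z}) \<inter> topspace Y))"
    have pos: "openin Y {z \<in> topspace Y. 0 < l s z}" if "s \<in> \<sigma>" for s
    proof -
      have "openin Y {z \<in> topspace Y. l s z \<in> {0<..}}"
        using contl[of s] that C_fin[OF \<sigma>] by (intro openin_continuous_map_preimage) auto
      then show ?thesis by simp
    qed
    have less: "openin Y {z \<in> topspace Y. l s' z < l s z}" if "s \<in> \<sigma>" "s' \<in> ?F" for s s'
    proof -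
      have "continuous_map Y euclideanreal (\<lambda>z. l s z - l s' z)"
        using that C_fin[OF \<sigma>] by (intro continuous_map_diff contl) auto
      then have "openin Y {z \<in> topspace Y. l s z - l s' z \<in> {0<..}}"
        by (rule openin_continuous_map_preimage) simp
      then show ?thesis by simp
    qed
    have inner: "openin Y ((\<Inter>s'\<in>?F. {z \<in> topspace Y. l s' z < l s z}) \<inter> topspace Y)" if "s \<in> \<sigma>" for s
      using M(3) less[OF that] by (intro openin_INT) auto
    have "openin Y (\<Inter>s\<in>\<sigma>. {z \<in> topspace Y. 0 < l s z} \<inter> ((\<Inter>s'\<in>?F. {z \<in> topspace Y. l s' z < l s z}) \<inter> topspace Y))"
      using C_fin[OF \<sigma>] openin_Int[OF pos inner] by (intro openin_INT2) auto
    then have "openin Y L"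
      unfolding L_def by (rule openin_Int[OF M(1)])
    moreover have "y \<in> L"
      using y M(2) C_fin[OF \<sigma>] unfolding L_def G_def by auto
    moreover have "L \<subseteq> G \<sigma>"
    proof
      fix z assume z: "z \<in> L"
      have zY: "z \<in> topspace Y" using z M(1) openin_subset unfolding L_def by blast
      have "l s' z < l s z" if "s \<in> \<sigma>" "s' \<in> \<W> - \<sigma>" for s s'
      proof (cases "s' \<in> ?F")
        case True
        then show ?thesis using z that unfolding L_def by blast
      next
        case False
        then have "z \<notin> V s'" using z that V(2)[of s'] unfolding L_def by blast
        then have "l s' z = 0" using l_zero[of s' z] that zY by blast
        then show ?thesis using z that unfolding L_def by auto
      qed
      then show "z \<in> G \<sigma>" using z zY unfolding L_def G_def by blast
    qed
    ultimately show "\<exists>T. openin Y T \<and> y \<in> T \<and> T \<subseteq> G \<sigma>" by blast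
  qed
  have G_disj: "\<sigma> = \<tau>" if "\<sigma> \<in> C i" "\<tau> \<in> C i" "y \<in> G \<sigma>" "y \<in> G \<tau>" for \<sigma> \<tau> i y
  proof (rule ccontr)
    assume "\<sigma> \<noteq> \<tau>"
    moreover have "card \<sigma> = card \<tau>"
      using that(1,2) unfolding C_def by simp
    moreover have "finite \<sigma>" "finite \<tau>"
      using C_fin that(1,2) by blast+
    ultimately have "\<not> \<sigma> \<subseteq> \<tau>" "\<not> \<tau> \<subseteq> \<sigma>"
      using card_subset_eq by metis+
    then obtain s t where st: "s \<in> \<sigma> - \<tau>" "t \<in> \<tau> - \<sigma>" by blast
    then have "s \<in> \<W>" "t \<in> \<W>" using C_fin[OF that(1)] C_fin[OF that(2)] by blast+
    then have "l t y < l s y" "l s y < l t y"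
      using st that(3,4) unfolding G_def by blast+
    then show False by simp
  qed
  \<comment> \<open>For fixed \<open>i\<close> the sets \<open>G \<sigma>\<close> are open and
    disjoint, and \<open>w i\<close> is constant on each; so the chosen member of the cover is
    locally constant on their union.\<close>
  define w where "w = (\<lambda>i y. SOME W. W \<in> (THE \<sigma>. \<sigma> \<in> C i \<and> y \<in> G \<sigma>))"
  have w: "w i y = (SOME W. W \<in> \<sigma>)" if "\<sigma> \<in> C i" "y \<in> G \<sigma>" for i y \<sigma>
  proof -
    have "(THE \<sigma>. \<sigma> \<in> C i \<and> y \<in> G \<sigma>) = \<sigma>"
    proof (rule the_equality)
      show "\<tau> = \<sigma>" if "\<tau> \<in> C i \<and> y \<in> G \<tau>" for \<tau>
        using G_disj[of \<tau> i \<sigma> y] that \<open>\<sigma> \<in> C i\<close> \<open>y \<in> G \<sigma>\<close> by simp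
    qed (use that in simp)
    then show ?thesis unfolding w_def by simp
  qed
  have w_in: "(SOME W. W \<in> \<sigma>) \<in> \<sigma>" if "\<sigma> \<in> C i" for i \<sigma>
    using C_fin[OF that] by (simp add: some_in_eq)
  show thesis
  proof
    show "openin Y (\<Union>\<sigma>\<in>C i. G \<sigma>)" for i
      using G_open by blast
    show "(\<Union>i\<le>m. \<Union>\<sigma>\<in>C i. G \<sigma>) = topspace Y"
    proof (intro equalityI subsetI)
      fix y assume y: "y \<in> topspace Y"
      \<comment> \<open>All positive coordinates together beat the vanishing ones, so this
        \<open>\<sigma>\<close> always qualifies. It has at most \<open>m + 1\<close> elements and
        its colour is one less, hence at most \<open>m\<close>.\<close>
      define \<sigma> where "\<sigma> = {W\<in>\<W>. l W y > 0}"
      obtain M where M: "openin Y M" "y \<in> M" "finite {W\<in>\<W>. W \<inter> M \<noteq> {}}"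
        using lf y unfolding locally_finite_in_def by blast
      have sub: "{W\<in>\<W>. y \<in> V W} \<subseteq> {W\<in>\<W>. W \<inter> M \<noteq> {}}" using V(2) M(2) by blast
      then have fin: "finite {W\<in>\<W>. y \<in> V W}" using M(3) finite_subset by blast
      have \<sigma>V: "\<sigma> \<subseteq> {W\<in>\<W>. y \<in> V W}" unfolding \<sigma>_def using l_pos y by blast
      have "card \<sigma> \<le> m + 1" using card_mono[OF fin \<sigma>V] V(4)[of y] by linarith
      moreover have "\<sigma> \<noteq> {}"
        using l_ex[OF y] unfolding \<sigma>_def by blast
      then have "card \<sigma> > 0" using fin \<sigma>V finite_subset card_gt_0_iff by blast
      ultimately obtain i where i: "i \<le> m" "\<sigma> \<in> C i"
        unfolding C_def using \<sigma>V by (cases "card \<sigma>") auto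
      have "y \<in> G \<sigma>" unfolding G_def \<sigma>_def using y l_ge
        by (auto simp: not_less intro: le_less_trans)
      with i show "y \<in> (\<Union>i\<le>m. \<Union>\<sigma>\<in>C i. G \<sigma>)" by blast
    qed (auto simp: G_def)
    fix i y assume "y \<in> (\<Union>\<sigma>\<in>C i. G \<sigma>)"
    then obtain \<sigma> where \<sigma>: "\<sigma> \<in> C i" "y \<in> G \<sigma>" by blast
    show "w i y \<in> \<W>" using w[OF \<sigma>] w_in[OF \<sigma>(1)] C_fin[OF \<sigma>(1)] by auto
    have "G \<sigma> \<subseteq> w i y"
    proof
      fix z assume z: "z \<in> G \<sigma>"
      have "w i y \<in> \<sigma>" using w[OF \<sigma>] w_in[OF \<sigma>(1)] by simp
      then show "z \<in> w i y"
        using z l_pos[of "w i y" z] V(2)[of "w i y"] C_fin[OF \<sigma>(1)] unfolding G_def by blast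
    qed
    moreover have "w i z = w i y" if "z \<in> G \<sigma>" for z
      using w[OF \<sigma>(1) that] w[OF \<sigma>] by simp
    ultimately show "\<exists>N. openin Y N \<and> y \<in> N \<and> N \<subseteq> (\<Union>\<sigma>\<in>C i. G \<sigma>) \<and> N \<subseteq> w i y \<and> (\<forall>z\<in>N. w i z = w i y)"
      using G_open[OF \<sigma>(1)] \<sigma> by blast
  qed
qed

lemma finite_partition_of_unity:
  assumes par: "paracompact_space Y" and reg: "regular_space Y" and I: "finite I"
    and Q: "\<And>i. i \<in> I \<Longrightarrow> openin Y (Q i)" "(\<Union>i\<in>I. Q i) = topspace Y"
  obtains t :: "'i \<Rightarrow> 'b \<Rightarrow> real" where "\<And>i. i \<in> I \<Longrightarrow> continuous_map Y euclideanreal (t i)"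
    "\<And>i y. i \<in> I \<Longrightarrow> y \<in> topspace Y \<Longrightarrow> 0 \<le> t i y" "\<And>y. y \<in> topspace Y \<Longrightarrow> (\<Sum>i\<in>I. t i y) = 1"
    "\<And>i y. i \<in> I \<Longrightarrow> y \<in> topspace Y - Q i \<Longrightarrow> \<exists>N. openin Y N \<and> y \<in> N \<and> (\<forall>z\<in>N. t i z = 0)"
proof -
  obtain l :: "'i \<Rightarrow> 'b \<Rightarrow> real" where contl: "\<And>i. i \<in> I \<Longrightarrow> continuous_map Y euclideanreal (l i)"
    and l_ge: "\<And>i y. i \<in> I \<Longrightarrow> y \<in> topspace Y \<Longrightarrow> 0 \<le> l i y"
    and l_ex: "\<And>y. y \<in> topspace Y \<Longrightarrow> \<exists>i\<in>I. 0 < l i y"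
    and l_loc: "\<And>i y. i \<in> I \<Longrightarrow> y \<in> topspace Y - Q i \<Longrightarrow>
      \<exists>N. openin Y N \<and> y \<in> N \<and> (\<forall>z\<in>N. l i z = 0)"
    apply (rule subordinate_functions[OF par reg Q], assumption)
    subgoal premises prems for l by (rule prems(1)[OF prems(2-5)])
    done
  have pos: "(\<Sum>i\<in>I. l i y) > 0" if y: "y \<in> topspace Y" for y
  proof -
    obtain i where i: "i \<in> I" "0 < l i y" using l_ex[OF y] by blast
    then show ?thesis using sum_pos2[OF I i(1), of "\<lambda>i. l i y"] l_ge y by simp
  qed
  show thesis
  proof
    fix i assume i: "i \<in> I"
    show "continuous_map Y euclideanreal (\<lambda>y. l i y / (\<Sum>j\<in>I. l j y))"
    proof (rule continuous_map_real_divide[OF contl[OF i] continuous_map_sum[OF I contl]])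
      show "(\<Sum>j\<in>I. l j y) \<noteq> 0" if "y \<in> topspace Y" for y
        using pos[OF that] by simp
    qed
    show "0 \<le> l i y / (\<Sum>j\<in>I. l j y)" if "y \<in> topspace Y" for y
      using l_ge[OF i that] pos[OF that] by simp
    fix y assume y: "y \<in> topspace Y - Q i"
    show "\<exists>N. openin Y N \<and> y \<in> N \<and> (\<forall>z\<in>N. l i z / (\<Sum>j\<in>I. l j z) = 0)"
      using l_loc[OF i y] by auto
  next
    show "(\<Sum>i\<in>I. l i y / (\<Sum>j\<in>I. l j y)) = 1" if "y \<in> topspace Y" for y
    proof -
      have "(\<Sum>i\<in>I. l i y / (\<Sum>j\<in>I. l j y)) = (\<Sum>i\<in>I. l i y) / (\<Sum>j\<in>I. l j y)"
        by (rule sum_divide_distrib[symmetric])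
      then show ?thesis using pos[OF that] by simp
    qed
  qed
qed

section \<open>Compatible families of local extensions\<close>

text \<open>The values on \<open>Z\<close> extend over the fibre by the extensor property; pasting
  with \<open>b\<close> gives a map on the closed set \<open>Z \<union> F\<close>, which extends to
  a neighbourhood \<open>U\<close>. Closedness of \<open>p\<close> then provides a preimage of an
  open set inside \<open>U\<close>.\<close>

lemma extension_near_fibre:
  assumes p: "continuous_map P Y p" "closed_map P Y p" and Y: "t1_space Y" and y: "y \<in> topspace Y"
    and ANE: "absolute_neighborhood_extensor K P"
    and AE: "absolute_extensor K (subtopology P {z \<in> topspace P. p z = y})"
    and Z: "closedin P Z" and b: "continuous_map (subtopology P Z) K b"
  obtains N e where "openin Y N" "y \<in> N"
    "continuous_map (subtopology P {z \<in> topspace P. p z \<in> N}) K e"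
    "\<And>z. z \<in> Z \<Longrightarrow> p z \<in> N \<Longrightarrow> e z = b z"
proof -
  define F where "F = {z \<in> topspace P. p z = y}"
  have F: "closedin P F"
    using closedin_continuous_map_preimage[OF p(1), of "{y}"] Y y
    unfolding F_def t1_space_closedin_singleton by simp
  have "continuous_map (subtopology (subtopology P F) (F \<inter> Z)) K b"
    using b by (metis continuous_map_from_subtopology inf_commute inf_left_idem subtopology_subtopology)
  moreover have "closedin (subtopology P F) (F \<inter> Z)"
    using Z by (simp add: closedin_subtopology_Int_closed)
  ultimately obtain a where a: "continuous_map (subtopology P F) K a" "\<And>z. z \<in> F \<inter> Z \<Longrightarrow> a z = b z"
    using AE unfolding absolute_extensor_def F_def[symmetric] by blast
  obtain c where c: "continuous_map (subtopology P (Z \<union> F)) K c"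
    "\<And>z i. \<lbrakk>i \<in> UNIV; z \<in> topspace (subtopology P (Z \<union> F)) \<inter> (if i then Z else F)\<rbrakk> \<Longrightarrow>
        c z = (if i then b else a) z"
  proof (rule pasting_lemma_exists_closed[of "UNIV :: bool set" "subtopology P (Z \<union> F)"
        "\<lambda>i. if i then Z else F" K "\<lambda>i. if i then b else a"])
    show "closedin (subtopology P (Z \<union> F)) (if i then Z else F)" for i
      using Z F by (auto intro: closedin_closed_subtopology [THEN iffD2] simp: closedin_subset closedin_Un closedin_closed_subtopology)
    show "continuous_map (subtopology (subtopology P (Z \<union> F)) (if i then Z else F)) K (if i then b else a)" for i
      using b a(1) by (auto simp: subtopology_subtopology Int_absorb1 Int_commute intro: continuous_map_from_subtopology_mono)
    show "(if i then b else a) x = (if j then b else a) x"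
      if "x \<in> topspace (subtopology P (Z \<union> F)) \<inter> (if i then Z else F) \<inter> (if j then Z else F)" for i j x
      using that a(2) by (auto split: if_splits)
  qed (auto simp: UNIV_bool)
  have sub: "Z \<subseteq> topspace P" "F \<subseteq> topspace P"
    using Z F closedin_subset by auto
  have cb: "c z = b z" if "z \<in> Z" for z
    using c(2)[of True z] that sub by auto
  have "closedin P (Z \<union> F)" using Z F by blast
  then obtain U e where U: "openin P U" "Z \<union> F \<subseteq> U" "continuous_map (subtopology P U) K e"
    "\<And>z. z \<in> Z \<union> F \<Longrightarrow> e z = c z"
    using ANE[unfolded absolute_neighborhood_extensor_def, rule_format, of "Z \<union> F" c] c(1)
    by metis
  have "{z \<in> topspace P. p z = y} \<subseteq> U"
    using U(2) unfolding F_def by blast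
  then obtain N where N: "openin Y N" "y \<in> N" "{z \<in> topspace P. p z \<in> N} \<subseteq> U"
    using p(2)[unfolded closed_map_fibre_neighbourhood, THEN conjunct2, rule_format, of U y] U(1) y
    by auto
  show thesis
  proof (rule that[OF N(1,2)])
    show "continuous_map (subtopology P {z \<in> topspace P. p z \<in> N}) K e"
      using U(3) N(3) by (rule continuous_map_from_subtopology_mono)
    show "e z = b z" if "z \<in> Z" for z using U(4) cb that by simp
  qed
qed

section \<open>Coherent families over the simplices of a cover\<close>

locale fibrewise_extension =
  fixes P :: "'p topology" and Y :: "'b topology" and K :: "'c topology" and p :: "'p \<Rightarrow> 'b"
    and A :: "'p set" and g :: "'p \<Rightarrow> 'c" and D :: "nat set \<Rightarrow> 'p set" and m :: nat
  assumes cont_p: "continuous_map P Y p" and closed_p: "closed_map P Y p"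
    and par: "paracompact_space Y" and reg: "regular_space Y" and t1: "t1_space Y"
    and ANE: "absolute_neighborhood_extensor K P"
    and AE: "\<And>y. y \<in> topspace Y \<Longrightarrow> absolute_extensor K (subtopology P {z \<in> topspace P. p z = y})"
    and closed_A: "closedin P A" and cont_g: "continuous_map (subtopology P A) K g"
    and closed_D: "\<And>S. closedin P (D S)" and D_Int: "\<And>S T. D S \<inter> D T = D (S \<inter> T)"
    and D_empty: "D {} = {}"
begin

text \<open>
  The application is \<open>P = I\<^sup>m \<times> X\<close>, with \<open>D S\<close> the product of \<open>X\<close> and the face spanned by \<open>S\<close> of an
  \<open>m\<close>-simplex in the cube \<open>I\<^sup>m\<close>. In a simplex \<open>(S, w)\<close> the vertex \<open>i \<in> S\<close> is mapped to the member \<open>w i\<close>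
  of the cover.
\<close>

definition over :: "'b set \<Rightarrow> 'p set" where
  "over N = {z \<in> topspace P. p z \<in> N}"

definition simplices :: "nat \<Rightarrow> 'b set set \<Rightarrow> (nat set \<times> (nat \<Rightarrow> 'b set)) set" where
  "simplices k \<W> = {(S,w). S \<subseteq> {..m} \<and> S \<noteq> {} \<and> card S \<le> k \<and> w ` S \<subseteq> \<W> \<and> (\<Inter>i\<in>S. w i) \<noteq> {}}"

text \<open>\<open>k\<close> bounds the number of vertices, so the dimension is less than
  \<open>k\<close>. Taking \<open>T = S\<close> in the last clause makes \<open>h S w\<close>, on
  \<open>D S\<close>, independent of the values of \<open>w\<close> outside \<open>S\<close>.
  Agreement is asked for only on \<open>D T\<close>; elsewhere in the cube the maps are
  auxiliary.\<close>

definition coherent :: "nat \<Rightarrow> 'b set set \<Rightarrow> (nat set \<Rightarrow> (nat \<Rightarrow> 'b set) \<Rightarrow> 'p \<Rightarrow> 'c) \<Rightarrow> bool" where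
  "coherent k \<W> h \<longleftrightarrow> (\<forall>(S,w) \<in> simplices k \<W>.
     continuous_map (subtopology P (over (\<Inter>i\<in>S. w i))) K (h S w) \<and>
     (\<forall>z\<in>A. p z \<in> (\<Inter>i\<in>S. w i) \<longrightarrow> h S w z = g z) \<and>
     (\<forall>T v. T \<subseteq> S \<and> T \<noteq> {} \<and> (\<forall>i\<in>T. v i = w i) \<longrightarrow>
        (\<forall>z\<in>D T. p z \<in> (\<Inter>i\<in>S. w i) \<longrightarrow> h T v z = h S w z)))"

lemma coherentD:
  assumes "coherent k \<W> h" "(S,w) \<in> simplices k \<W>"
  shows "continuous_map (subtopology P (over (\<Inter>i\<in>S. w i))) K (h S w)"
    and "z \<in> A \<Longrightarrow> p z \<in> (\<Inter>i\<in>S. w i) \<Longrightarrow> h S w z = g z"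
    and "T \<subseteq> S \<Longrightarrow> T \<noteq> {} \<Longrightarrow> (\<And>i. i \<in> T \<Longrightarrow> v i = w i) \<Longrightarrow> z \<in> D T \<Longrightarrow>
           p z \<in> (\<Inter>i\<in>S. w i) \<Longrightarrow> h T v z = h S w z"
proof -
  have *: "continuous_map (subtopology P (over (\<Inter>i\<in>S. w i))) K (h S w) \<and>
     (\<forall>z\<in>A. p z \<in> (\<Inter>i\<in>S. w i) \<longrightarrow> h S w z = g z) \<and>
     (\<forall>T v. T \<subseteq> S \<and> T \<noteq> {} \<and> (\<forall>i\<in>T. v i = w i) \<longrightarrow>
        (\<forall>z\<in>D T. p z \<in> (\<Inter>i\<in>S. w i) \<longrightarrow> h T v z = h S w z))"
    using bspec[OF assms(1)[unfolded coherent_def] assms(2)] unfolding prod.case .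
  show "continuous_map (subtopology P (over (\<Inter>i\<in>S. w i))) K (h S w)"
    using *[THEN conjunct1] .
  show "h S w z = g z" if "z \<in> A" "p z \<in> (\<Inter>i\<in>S. w i)"
    using *[THEN conjunct2, THEN conjunct1, rule_format, OF that] .
  show "h T v z = h S w z" if "T \<subseteq> S" "T \<noteq> {}" "\<And>i. i \<in> T \<Longrightarrow> v i = w i" "z \<in> D T"
      "p z \<in> (\<Inter>i\<in>S. w i)"
    using *[THEN conjunct2, THEN conjunct2, rule_format, of T v z] that by simp
qed

lemma over_mono: "M \<subseteq> N \<Longrightarrow> over M \<subseteq> over N"
  unfolding over_def by blast

text \<open>The map \<open>g\<close> on \<open>A\<close> and the maps of the facets together
  prescribe values on a closed set, which extend near the fibre of \<open>y\<close>. For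
  \<open>k = 0\<close> there are no facets and \<open>g\<close> alone is extended.\<close>

lemma fill_simplex:
  assumes h: "coherent k \<W> h" and op: "\<And>W. W \<in> \<W> \<Longrightarrow> openin Y W"
    and S: "S \<subseteq> {..m}" "card S = Suc k" and w: "\<And>i. i \<in> S \<Longrightarrow> w i \<in> \<W>" "\<And>i. i \<in> S \<Longrightarrow> y \<in> w i"
  shows "\<exists>N e. openin Y N \<and> y \<in> N \<and> continuous_map (subtopology P (over N)) K e \<and>
    (\<forall>z\<in>A. p z \<in> N \<longrightarrow> e z = g z) \<and>
    (\<forall>i\<in>S. S - {i} \<noteq> {} \<longrightarrow> (\<forall>z\<in>D (S - {i}). p z \<in> N \<longrightarrow> e z = h (S - {i}) w z))"
proof -
  define U where "U = (\<Inter>i\<in>S. w i)"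
  have finS: "finite S" "S \<noteq> {}" using S card_gt_0_iff[of S] by auto
  have U: "openin Y U"
    unfolding U_def using finS w(1) op by (intro openin_INT2) auto
  have "y \<in> U" unfolding U_def using w(2) by blast
  then have y: "y \<in> topspace Y" using U openin_subset by blast
  \<comment> \<open>The facet maps live over open sets only, so the facets are cut off over a closed
    \<open>C\<close>. The filling is finally used over \<open>G\<close>, where the cut is not
    felt.\<close>
  obtain G C where GC: "openin Y G" "closedin Y C" "y \<in> G" "G \<subseteq> C" "C \<subseteq> U"
    using reg U \<open>y \<in> U\<close> unfolding neighbourhood_base_of_closedin [symmetric] neighbourhood_base_of
    by meson
  have overC: "closedin P (over C)"
    unfolding over_def using closedin_continuous_map_preimage[OF cont_p GC(2)] .
  have face: "(S - {i}, w) \<in> simplices k \<W>" if "i \<in> S" "S - {i} \<noteq> {}" for i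
  proof -
    have "y \<in> (\<Inter>j\<in>S - {i}. w j)" using w(2) by blast
    moreover have "card (S - {i}) \<le> k" using S(2) that(1) by simp
    ultimately show ?thesis
      using that(2) S(1) w(1) unfolding simplices_def by blast
  qed
  have U_sub: "U \<subseteq> (\<Inter>j\<in>S - {i}. w j)" for i
    unfolding U_def by blast
  let ?I = "insert None (Some ` S)"
  define B where "B = (\<lambda>j. case j of None \<Rightarrow> A | Some i \<Rightarrow> D (S - {i}) \<inter> over C)"
  define b where "b = (\<lambda>j. case j of None \<Rightarrow> g | Some i \<Rightarrow> h (S - {i}) w)"
  define Z where "Z = (\<Union>j\<in>?I. B j)"
  have B: "closedin P (B j)" for j
    unfolding B_def using closed_A closed_D overC by (auto split: option.split)
  then have Z: "closedin P Z"
    unfolding Z_def using finS by (intro closedin_Union) auto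
  have BZ: "B j \<subseteq> Z" if "j \<in> ?I" for j
    unfolding Z_def using that by blast
  have contb: "continuous_map (subtopology P (B j)) K (b j)" if j: "j \<in> ?I" for j
  proof (cases j)
    case None
    then show ?thesis using cont_g unfolding B_def b_def by simp
  next
    case (Some i)
    then have i: "i \<in> S" using j by auto
    show ?thesis
    proof (cases "S - {i} = {}")
      case True
      then have "B j = {}" using Some D_empty unfolding B_def by (metis Int_empty_left option.simps(5))
      then show ?thesis by (simp add: continuous_map_on_empty)
    next
      case False
      have "over C \<subseteq> over (\<Inter>j\<in>S - {i}. w j)"
        by (rule over_mono) (use GC(5) U_sub in blast)
      then show ?thesis
        using coherentD(1)[OF h face[OF i False]] Some unfolding B_def b_def
        by (auto intro: continuous_map_from_subtopology_mono)
    qed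
  qed
  have gface: "b None z = b (Some i) z" if "i \<in> S" "z \<in> B None" "z \<in> B (Some i)" for i z
  proof -
    have "S - {i} \<noteq> {}"
    proof
      assume "S - {i} = {}"
      then have "D (S - {i}) = {}" by (simp only: D_empty)
      then show False using that(3) unfolding B_def by simp
    qed
    moreover have "p z \<in> (\<Inter>j\<in>S - {i}. w j)"
      using that GC(5) U_sub[of i] unfolding B_def over_def by auto
    ultimately show ?thesis
      using coherentD(2)[OF h face[OF that(1)]] that unfolding b_def B_def by simp
  qed
  have faces: "b (Some i) z = b (Some j) z"
    if ij: "i \<in> S" "j \<in> S" "z \<in> B (Some i)" "z \<in> B (Some j)" for i j z
  proof -
    \<comment> \<open>Two facets meet in the face of their common vertices, where coherence
      identifies both maps with the map of that face. For an edge there is no common vertex, and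
      \<open>D_empty\<close> excludes an overlap.\<close>
    have z: "z \<in> D ((S - {i}) \<inter> (S - {j}))"
      using ij D_Int unfolding B_def by auto
    then have ne: "(S - {i}) \<inter> (S - {j}) \<noteq> {}" using D_empty by auto
    have "p z \<in> U" using ij GC(5) unfolding B_def over_def by auto
    then have "p z \<in> (\<Inter>l\<in>S - {i}. w l)" "p z \<in> (\<Inter>l\<in>S - {j}. w l)" using U_sub by blast+
    moreover have "S - {i} \<noteq> {}" "S - {j} \<noteq> {}" using ne by blast+
    ultimately have "h ((S - {i}) \<inter> (S - {j})) w z = h (S - {i}) w z"
      "h ((S - {i}) \<inter> (S - {j})) w z = h (S - {j}) w z"
      using coherentD(3)[OF h face[OF ij(1)] Int_lower1 ne refl z]
        coherentD(3)[OF h face[OF ij(2)] Int_lower2 ne refl z] by simp_all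
    then show ?thesis unfolding b_def by simp
  qed
  obtain c where c: "continuous_map (subtopology P Z) K c"
    "\<And>z j. \<lbrakk>j \<in> ?I; z \<in> topspace (subtopology P Z) \<inter> B j\<rbrakk> \<Longrightarrow> c z = b j z"
  proof (rule pasting_lemma_exists_closed[of ?I "subtopology P Z" B K b])
    show "finite ?I" using finS by simp
    show "topspace (subtopology P Z) \<subseteq> \<Union>(B ` ?I)" unfolding Z_def by auto
    show "closedin (subtopology P Z) (B j)" if "j \<in> ?I" for j
      using B BZ[OF that] Z by (simp add: closedin_closed_subtopology)
    show "continuous_map (subtopology (subtopology P Z) (B j)) K (b j)" if "j \<in> ?I" for j
      using contb[OF that] BZ[OF that] by (simp add: subtopology_subtopology Int_absorb1)
    show "b i z = b j z" if "i \<in> ?I" "j \<in> ?I" "z \<in> topspace (subtopology P Z) \<inter> B i \<inter> B j" for i j z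
    proof -
      have z: "z \<in> B i" "z \<in> B j" using that by blast+
      show ?thesis
      proof (cases i)
        case None
        then show ?thesis using z that(2) gface by (cases j) auto
      next
        case (Some i')
        then have i': "i' \<in> S" using that(1) by blast
        show ?thesis
        proof (cases j)
          case None
          then show ?thesis using gface[of i' z] i' z Some by simp
        next
          case (Some j')
          then have "j' \<in> S" using that(2) by blast
          then show ?thesis using faces[of i' j' z] i' z Some \<open>i = Some i'\<close> by simp
        qed
      qed
    qed
  qed blast
  have cB: "c z = b j z" if "j \<in> ?I" "z \<in> B j" for z j
    using c(2)[OF that(1)] that BZ[OF that(1)] closedin_subset[OF Z] by auto
  obtain N e where N: "openin Y N" "y \<in> N" "continuous_map (subtopology P {z \<in> topspace P. p z \<in> N}) K e"
    "\<And>z. z \<in> Z \<Longrightarrow> p z \<in> N \<Longrightarrow> e z = c z"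
    using extension_near_fibre[OF cont_p closed_p t1 y ANE AE[OF y] Z c(1)] by blast
  show ?thesis
  proof (intro exI conjI ballI impI)
    show "openin Y (N \<inter> G)" "y \<in> N \<inter> G" using N(1,2) GC(1,3) by auto
    show "continuous_map (subtopology P (over (N \<inter> G))) K e"
      using N(3) over_mono[of "N \<inter> G" N] unfolding over_def[of N, symmetric]
      by (auto intro: continuous_map_from_subtopology_mono)
    show "e z = g z" if "z \<in> A" "p z \<in> N \<inter> G" for z
    proof -
      have "z \<in> B None" using that unfolding B_def by simp
      then show ?thesis using cB[of None z] BZ[of None] N(4)[of z] that unfolding b_def by auto
    qed
    show "e z = h (S - {i}) w z" if "i \<in> S" "S - {i} \<noteq> {}" "z \<in> D (S - {i})" "p z \<in> N \<inter> G" for i z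
    proof -
      have "z \<in> topspace P" using that(3) closed_D closedin_subset by blast
      then have "z \<in> B (Some i)" using that GC(4) unfolding B_def over_def by auto
      then show ?thesis using cB[of "Some i" z] BZ[of "Some i"] N(4)[of z] that unfolding b_def by auto
    qed
  qed
qed

text \<open>
  Every element of the new cover lies in a set over which all \<open>k\<close>-dimensional simplices of the old
  cover that come near it have been filled. Simplices of the new cover are mapped to simplices of
  the old one by \<open>\<rho>\<close>, and a new \<open>k\<close>-dimensional simplex uses the fillings chosen for its first vertex.
\<close>

lemma coherent_Suc:
  assumes h: "coherent k \<W> h" and cov: "open_cover_of Y \<W>" and lf: "locally_finite_in Y \<W>"
  shows "\<exists>\<W>' h'. open_cover_of Y \<W>' \<and> locally_finite_in Y \<W>' \<and> coherent (Suc k) \<W>' h'"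
proof -
  have op: "openin Y W" if "W \<in> \<W>" for W
    using that cov unfolding open_cover_of_def by blast
  \<comment> \<open>As the closure of \<open>V W\<close> lies in \<open>W\<close>, the members with
    \<open>y\<close> in the closure of \<open>V W\<close> all contain \<open>y\<close>; any
    labelling by them is a simplex at \<open>y\<close> and can be filled there.\<close>
  obtain V where V: "\<And>W. W \<in> \<W> \<Longrightarrow> openin Y (V W)"
    "\<And>W. W \<in> \<W> \<Longrightarrow> Y closure_of (V W) \<subseteq> W" "(\<Union>W\<in>\<W>. V W) = topspace Y"
    using paracompact_regular_shrinking[OF par reg, of \<W> "\<lambda>W. W"] op cov
    unfolding open_cover_of_def by auto
  have VW: "V W \<subseteq> W" if "W \<in> \<W>" for W
    using V(2)[OF that] closure_of_subset[OF openin_subset[OF V(1)[OF that]]] by blast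
  define good where "good = (\<lambda>y N e.
    openin Y N \<and> y \<in> N \<and> (\<forall>W\<in>\<W>. V W \<inter> N \<noteq> {} \<longrightarrow> y \<in> Y closure_of V W) \<and>
    (\<forall>S w. S \<subseteq> {..m} \<and> card S = Suc k \<and> w \<in> extensional S \<and>
       (\<forall>i\<in>S. w i \<in> \<W> \<and> y \<in> Y closure_of V (w i)) \<longrightarrow>
       continuous_map (subtopology P (over N)) K (e S w) \<and>
       (\<forall>z\<in>A. p z \<in> N \<longrightarrow> e S w z = g z) \<and>
       (\<forall>i\<in>S. S - {i} \<noteq> {} \<longrightarrow> (\<forall>z\<in>D (S - {i}). p z \<in> N \<longrightarrow> e S w z = h (S - {i}) w z))))"
  have "\<exists>N e. good y N e" if y: "y \<in> topspace Y" for y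
  proof -
    let ?Wy = "{W\<in>\<W>. y \<in> Y closure_of V W}"
    \<comment> \<open>Only finitely many labels are available at \<open>y\<close>, and
      extensionality leaves one function for each labelling; so a single neighbourhood serves all
      fillings.\<close>
    define I where "I = {(S,w). S \<subseteq> {..m} \<and> card S = Suc k \<and> w \<in> S \<rightarrow>\<^sub>E ?Wy}"
    have lfV: "locally_finite_in Y (V ` \<W>)"
      using locally_finite_in_refinement[OF lf VW] .
    obtain M where M: "openin Y M" "y \<in> M" "finite {W\<in>\<W>. W \<inter> M \<noteq> {}}"
      using lf y unfolding locally_finite_in_def by blast
    have "?Wy \<subseteq> {W\<in>\<W>. W \<inter> M \<noteq> {}}"
      using V(2) M(2) by blast
    then have finWy: "finite ?Wy" using M(3) finite_subset by blast
    have "I = Sigma {S. S \<subseteq> {..m} \<and> card S = Suc k} (\<lambda>S. S \<rightarrow>\<^sub>E ?Wy)"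
      unfolding I_def by auto
    then have finI: "finite I"
      using finWy by (auto intro!: finite_SigmaI finite_PiE intro: finite_subset[of _ "{..m}"])
    have "\<forall>q\<in>I. \<exists>N e. openin Y N \<and> y \<in> N \<and> continuous_map (subtopology P (over N)) K e \<and>
      (\<forall>z\<in>A. p z \<in> N \<longrightarrow> e z = g z) \<and>
      (\<forall>i\<in>fst q. fst q - {i} \<noteq> {} \<longrightarrow>
         (\<forall>z\<in>D (fst q - {i}). p z \<in> N \<longrightarrow> e z = h (fst q - {i}) (snd q) z))"
    proof
      fix q assume q: "q \<in> I"
      have w: "snd q i \<in> \<W>" "y \<in> snd q i" if "i \<in> fst q" for i
      proof -
        have "snd q i \<in> ?Wy" using q that unfolding I_def by auto
        then show "snd q i \<in> \<W>" "y \<in> snd q i" using V(2) by auto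
      qed
      show "\<exists>N e. openin Y N \<and> y \<in> N \<and> continuous_map (subtopology P (over N)) K e \<and>
        (\<forall>z\<in>A. p z \<in> N \<longrightarrow> e z = g z) \<and>
        (\<forall>i\<in>fst q. fst q - {i} \<noteq> {} \<longrightarrow>
           (\<forall>z\<in>D (fst q - {i}). p z \<in> N \<longrightarrow> e z = h (fst q - {i}) (snd q) z))"
        by (rule fill_simplex[OF h op _ _ w]) (use q in \<open>auto simp: I_def\<close>)
    qed
    then obtain N e where N: "\<And>q. q \<in> I \<Longrightarrow> openin Y (N q) \<and> y \<in> N q"
      and e: "\<And>q. q \<in> I \<Longrightarrow> continuous_map (subtopology P (over (N q))) K (e q) \<and>
      (\<forall>z\<in>A. p z \<in> N q \<longrightarrow> e q z = g z) \<and>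
      (\<forall>i\<in>fst q. fst q - {i} \<noteq> {} \<longrightarrow>
         (\<forall>z\<in>D (fst q - {i}). p z \<in> N q \<longrightarrow> e q z = h (fst q - {i}) (snd q) z))"
      by metis
    define far where "far = (\<Union>W\<in>{W\<in>\<W>. y \<notin> Y closure_of V W}. Y closure_of V W)"
    have "closedin Y (\<Union>((\<lambda>S. Y closure_of S) ` (V ` {W\<in>\<W>. y \<notin> Y closure_of V W})))"
      by (rule closedin_Union_locally_finite_closure[OF locally_finite_in_subset[OF lfV]]) blast
    then have far: "closedin Y far" unfolding far_def image_image .
    define L where "L = (topspace Y - far) \<inter> (\<Inter>q\<in>I. N q)"
    have L: "openin Y L" "y \<in> L"
    proof -
      have "L = (topspace Y - far) \<inter> \<Inter>(insert (topspace Y - far) (N ` I))"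
        unfolding L_def by blast
      moreover have "openin Y (\<Inter>(insert (topspace Y - far) (N ` I)))"
        using finI N far by (intro openin_Inter) auto
      ultimately show "openin Y L" using far by auto
      show "y \<in> L" using y N unfolding L_def far_def by auto
    qed
    have LN: "L \<subseteq> N q" if "q \<in> I" for q unfolding L_def using that by blast
    have "good y L (\<lambda>S w. e (S,w))"
      unfolding good_def
    proof (intro conjI L ballI allI impI)
      fix W assume W: "W \<in> \<W>" "V W \<inter> L \<noteq> {}"
      show "y \<in> Y closure_of V W"
      proof (rule ccontr)
        assume "y \<notin> Y closure_of V W"
        then have "V W \<subseteq> far"
          using W(1) closure_of_subset[OF openin_subset[OF V(1)[OF W(1)]]] unfolding far_def by blast
        then show False using W(2) unfolding L_def by blast
      qed
    next
      fix S w assume "S \<subseteq> {..m} \<and> card S = Suc k \<and> w \<in> extensional S \<and>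
       (\<forall>i\<in>S. w i \<in> \<W> \<and> y \<in> Y closure_of V (w i))"
      then have q: "(S,w) \<in> I" unfolding I_def by (auto simp: PiE_def)
      show "continuous_map (subtopology P (over L)) K (e (S,w))"
        using e[OF q] over_mono[OF LN[OF q]] by (auto intro: continuous_map_from_subtopology_mono)
      show "e (S,w) z = g z" if "z \<in> A" "p z \<in> L" for z
        using e[OF q] LN[OF q] that by blast
      show "e (S,w) z = h (S - {i}) w z" if "i \<in> S" "S - {i} \<noteq> {}" "z \<in> D (S - {i})" "p z \<in> L" for i z
        using e[OF q] LN[OF q] that by auto
    qed
    then show ?thesis by blast
  qed
  then obtain N e where good: "\<And>y. y \<in> topspace Y \<Longrightarrow> good y (N y) (e y)"
    by metis
  define \<U> where "\<U> = {N y \<inter> V W |y W. y \<in> topspace Y \<and> W \<in> \<W>}"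
  have "open_cover_of Y \<U>"
    unfolding open_cover_of_def
  proof (intro conjI ballI equalityI subsetI)
    show "openin Y U" if "U \<in> \<U>" for U
      using that good V(1) unfolding \<U>_def good_def by auto
    then show "y \<in> topspace Y" if "y \<in> \<Union>\<U>" for y
      using that openin_subset by blast
    fix y assume y: "y \<in> topspace Y"
    then have "y \<in> N y" using good unfolding good_def by blast
    moreover obtain W where "W \<in> \<W>" "y \<in> V W" using V(3) y by blast
    ultimately show "y \<in> \<Union>\<U>" unfolding \<U>_def using y by blast
  qed
  then obtain \<W>' where \<W>': "open_cover_of Y \<W>'" "refines \<W>' \<U>" "locally_finite_in Y \<W>'"
    using par unfolding paracompact_space_def by blast
  have "\<forall>W'\<in>\<W>'. \<exists>y W. y \<in> topspace Y \<and> W \<in> \<W> \<and> W' \<subseteq> N y \<inter> V W"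
    using \<W>'(2) unfolding refines_def \<U>_def by blast
  then obtain \<eta> \<rho> where \<eta>: "\<And>W'. W' \<in> \<W>' \<Longrightarrow> \<eta> W' \<in> topspace Y" "\<And>W'. W' \<in> \<W>' \<Longrightarrow> W' \<subseteq> N (\<eta> W')"
    and \<rho>: "\<And>W'. W' \<in> \<W>' \<Longrightarrow> \<rho> W' \<in> \<W>" "\<And>W'. W' \<in> \<W>' \<Longrightarrow> W' \<subseteq> V (\<rho> W')"
    by (metis le_inf_iff)
  \<comment> \<open>The choice of vertex is arbitrary: the facet data prescribed at any centre
    depend on \<open>\<rho> \<circ> w\<close> only, so fillings from different centres have the same
    boundary values. Labels may coincide under \<open>\<rho>\<close>, which is harmless because
    \<open>S\<close> is kept.\<close>
  define h' where "h' = (\<lambda>S w. if card S \<le> k then h S (\<rho> \<circ> w)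
     else e (\<eta> (w (Min S))) S (restrict (\<rho> \<circ> w) S))"
  have "coherent (Suc k) \<W>' h'"
    unfolding coherent_def
  proof (rule ballI, clarify)
    fix S w assume Sw: "(S,w) \<in> simplices (Suc k) \<W>'"
    define U where "U = (\<Inter>i\<in>S. w i)"
    have S: "S \<subseteq> {..m}" "S \<noteq> {}" "card S \<le> Suc k" "\<And>i. i \<in> S \<Longrightarrow> w i \<in> \<W>'" "U \<noteq> {}"
      using Sw unfolding simplices_def U_def by auto
    have finS: "finite S" using S(1) finite_subset by blast
    have U_sub: "U \<subseteq> \<rho> (w i)" if "i \<in> S" for i
    proof -
      have "U \<subseteq> w i" unfolding U_def using that by blast
      also have "\<dots> \<subseteq> V (\<rho> (w i))" using \<rho>(2) S(4) that by blast
      also have "\<dots> \<subseteq> \<rho> (w i)" using VW \<rho>(1) S(4) that by blast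
      finally show ?thesis .
    qed
    have "continuous_map (subtopology P (over U)) K (h' S w) \<and>
       (\<forall>z\<in>A. p z \<in> U \<longrightarrow> h' S w z = g z) \<and>
       (\<forall>T v. T \<subseteq> S \<and> T \<noteq> {} \<and> (\<forall>i\<in>T. v i = w i) \<longrightarrow>
          (\<forall>z\<in>D T. p z \<in> U \<longrightarrow> h' T v z = h' S w z))"
    proof (cases "card S \<le> k")
      case True
      have U_sub': "U \<subseteq> (\<Inter>i\<in>S. (\<rho> \<circ> w) i)" using U_sub by auto
      have Sk: "(S, \<rho> \<circ> w) \<in> simplices k \<W>"
        using S True \<rho>(1) U_sub' unfolding simplices_def by fastforce
      have h'S: "h' S w = h S (\<rho> \<circ> w)" unfolding h'_def using True by simp
      show ?thesis
      proof (intro conjI ballI allI impI)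
        show "continuous_map (subtopology P (over U)) K (h' S w)"
          unfolding h'S by (rule continuous_map_from_subtopology_mono[OF coherentD(1)[OF h Sk] over_mono[OF U_sub']])
        show "h' S w z = g z" if "z \<in> A" "p z \<in> U" for z
          unfolding h'S using coherentD(2)[OF h Sk] that U_sub' by blast
        fix T v z assume T: "T \<subseteq> S \<and> T \<noteq> {} \<and> (\<forall>i\<in>T. v i = w i)" and z: "z \<in> D T" "p z \<in> U"
        have "card T \<le> k" using T True card_mono[OF finS] by (meson order_trans)
        then have "h' T v = h T (\<rho> \<circ> v)" unfolding h'_def by simp
        moreover have "h T (\<rho> \<circ> v) z = h S (\<rho> \<circ> w) z"
          by (rule coherentD(3)[OF h Sk]) (use T z U_sub' in auto)
        ultimately show "h' T v z = h' S w z" unfolding h'S by simp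
      qed
    next
      case False
      then have cS: "card S = Suc k" using S(3) by simp
      define y where "y = \<eta> (w (Min S))"
      define u where "u = restrict (\<rho> \<circ> w) S"
      have h'S: "h' S w = e y S u" unfolding h'_def y_def u_def using False by simp
      have MS: "Min S \<in> S" using finS S(2) by simp
      have y: "y \<in> topspace Y" unfolding y_def using \<eta>(1) S(4) MS by blast
      have UN: "U \<subseteq> N y" unfolding y_def U_def using \<eta>(2)[OF S(4)[OF MS]] MS by blast
      \<comment> \<open>The nonempty intersection required of a simplex enters here: all its labels
        share a point of \<open>N y\<close>, so \<open>good\<close> admits every
        \<open>\<rho> (w i)\<close>, whichever vertex supplied \<open>y\<close>.\<close>
      have u: "u i \<in> \<W> \<and> y \<in> Y closure_of V (u i)" if i: "i \<in> S" for i
      proof -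
        have ui: "u i = \<rho> (w i)" unfolding u_def using i by simp
        have "U \<subseteq> V (\<rho> (w i))" unfolding U_def using \<rho>(2)[OF S(4)[OF i]] i by blast
        then have "V (\<rho> (w i)) \<inter> N y \<noteq> {}" using UN S(5) by blast
        then show ?thesis
          using good[OF y] \<rho>(1)[OF S(4)[OF i]] unfolding good_def ui by blast
      qed
      have "S \<subseteq> {..m} \<and> card S = Suc k \<and> u \<in> extensional S \<and>
         (\<forall>i\<in>S. u i \<in> \<W> \<and> y \<in> Y closure_of V (u i))"
        using S(1) cS u unfolding u_def by simp
      then have fill: "continuous_map (subtopology P (over (N y))) K (e y S u)"
         "\<And>z. z \<in> A \<Longrightarrow> p z \<in> N y \<Longrightarrow> e y S u z = g z"
         "\<And>i z. i \<in> S \<Longrightarrow> S - {i} \<noteq> {} \<Longrightarrow> z \<in> D (S - {i}) \<Longrightarrow> p z \<in> N y \<Longrightarrow>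
             e y S u z = h (S - {i}) u z"
        using good[OF y] unfolding good_def by blast+
      show ?thesis
      proof (intro conjI ballI allI impI)
        show "continuous_map (subtopology P (over U)) K (h' S w)"
          unfolding h'S by (rule continuous_map_from_subtopology_mono[OF fill(1) over_mono[OF UN]])
        show "h' S w z = g z" if "z \<in> A" "p z \<in> U" for z
          unfolding h'S using fill(2) that UN by blast
        fix T v z assume T: "T \<subseteq> S \<and> T \<noteq> {} \<and> (\<forall>i\<in>T. v i = w i)" and z: "z \<in> D T" "p z \<in> U"
        show "h' T v z = h' S w z"
        proof (cases "T = S")
          case True
          then have "restrict (\<rho> \<circ> v) S = u" "v (Min S) = w (Min S)"
            using T MS unfolding u_def by (auto intro!: restrict_ext)
          then have "h' T v = e y S u" unfolding h'_def y_def using True False by simp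
          then show ?thesis unfolding h'S by simp
        next
          case neq: False
          \<comment> \<open>The filling is known to agree with facets only; a smaller face is
            reached through a facet containing it and the coherence of \<open>h\<close>.\<close>
          then obtain i where i: "i \<in> S" "T \<subseteq> S - {i}" using T by blast
          have "S - {i} \<noteq> {}" using i(2) T by blast
          have cT: "card T \<le> k"
            using card_mono[OF _ i(2)] finS cS i(1) by simp
          have "D T \<inter> D (S - {i}) = D T"
            using D_Int[of T "S - {i}"] i(2) by (simp add: Int_absorb2)
          then have zi: "z \<in> D (S - {i})" using z(1) by blast
          have U_sub': "U \<subseteq> (\<Inter>j\<in>S - {i}. u j)"
            using U_sub unfolding u_def by auto
          have face: "(S - {i}, u) \<in> simplices k \<W>"
            using S cS i(1) finS \<open>S - {i} \<noteq> {}\<close> u U_sub' unfolding simplices_def by auto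
          have "h' T v z = h T (\<rho> \<circ> v) z" unfolding h'_def using cT by simp
          also have "\<dots> = h (S - {i}) u z"
          proof (rule coherentD(3)[OF h face i(2)])
            show "T \<noteq> {}" using T by blast
            show "(\<rho> \<circ> v) j = u j" if "j \<in> T" for j
              using that T unfolding u_def by auto
          qed (use z U_sub' in auto)
          also have "\<dots> = e y S u z"
            using fill(3)[OF i(1) \<open>S - {i} \<noteq> {}\<close> zi] z(2) UN by auto
          finally show ?thesis unfolding h'S .
        qed
      qed
    qed
    then show "continuous_map (subtopology P (over (\<Inter>i\<in>S. w i))) K (h' S w) \<and>
       (\<forall>z\<in>A. p z \<in> (\<Inter>i\<in>S. w i) \<longrightarrow> h' S w z = g z) \<and>
       (\<forall>T v. T \<subseteq> S \<and> T \<noteq> {} \<and> (\<forall>i\<in>T. v i = w i) \<longrightarrow>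
          (\<forall>z\<in>D T. p z \<in> (\<Inter>i\<in>S. w i) \<longrightarrow> h' T v z = h' S w z))"
      unfolding U_def .
  qed
  with \<W>' show ?thesis by blast
qed

lemma coherent_exists:
  "\<exists>\<W> h. open_cover_of Y \<W> \<and> locally_finite_in Y \<W> \<and> coherent k \<W> h"
proof (induction k)
  case 0
  \<comment> \<open>A simplex has a vertex, so for \<open>k = 0\<close> there is nothing to satisfy;
    the first inductive step already produces the local extensions of \<open>g\<close>.\<close>
  have "S = {}" if "S \<subseteq> {..m}" "card S = 0" for S
    using that finite_subset[of S "{..m}"] by auto
  then have "simplices 0 {topspace Y} = {}"
    unfolding simplices_def by auto
  then have "coherent 0 {topspace Y} h" for h
    unfolding coherent_def by simp
  moreover have "open_cover_of Y {topspace Y}" "locally_finite_in Y {topspace Y}"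
    unfolding open_cover_of_def by (auto intro: finite_imp_locally_finite_in)
  ultimately show ?case by blast
next
  case (Suc k)
  then show ?case using coherent_Suc by blast
qed

end

section \<open>Faces of a simplex in the cube\<close>

text \<open>
  The vertices of the simplex are the origin (number \<open>m\<close>) and the unit vectors. Its last barycentric
  coordinate is allowed to be negative, so \<open>face m S\<close> is the part of the affine hull of a face that
  lies in the cube.
\<close>

definition barycentric :: "nat \<Rightarrow> nat \<Rightarrow> (nat \<Rightarrow> real) \<Rightarrow> real" where
  "barycentric m i t = (if i < m then t i else 1 - (\<Sum>j<m. t j))"

definition face :: "nat \<Rightarrow> nat set \<Rightarrow> (nat \<Rightarrow> real) set" where
  "face m S = {t \<in> topspace (unit_cube m). \<forall>i\<le>m. i \<notin> S \<longrightarrow> barycentric m i t = 0}"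

lemma continuous_map_barycentric: "continuous_map (unit_cube m) euclideanreal (barycentric m i)"
proof -
  have "continuous_map (unit_cube m) euclideanreal (\<lambda>t. t j)" if "j < m" for j
    using continuous_map_product_projection[of j "{..<m}" "\<lambda>_. top_of_set {0..1::real}"] that
    unfolding unit_cube_def by (auto simp: continuous_map_in_subtopology)
  then show ?thesis
    unfolding barycentric_def by (cases "i < m") (auto intro!: continuous_map_diff continuous_map_sum)
qed

lemma closedin_face: "closedin (unit_cube m) (face m S)"
proof -
  define Z where "Z = (\<lambda>i. {t \<in> topspace (unit_cube m). barycentric m i t \<in> {0}})"
  have "closedin (unit_cube m) (Z i)" for i
    unfolding Z_def by (rule closedin_continuous_map_preimage[OF continuous_map_barycentric]) simp
  then have "closedin (unit_cube m) (\<Inter>(insert (topspace (unit_cube m)) (Z ` ({..m} - S))))"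
    by (intro closedin_Inter) auto
  also have "\<Inter>(insert (topspace (unit_cube m)) (Z ` ({..m} - S))) = face m S"
    unfolding face_def Z_def by blast
  finally show ?thesis .
qed

lemma face_Int: "face m S \<inter> face m T = face m (S \<inter> T)"
  unfolding face_def by blast

text \<open>The coordinates sum to 1, so they cannot all vanish.\<close>

lemma face_empty: "face m {} = {}"
proof -
  have False if t: "t \<in> face m {}" for t
  proof -
    have z: "barycentric m i t = 0" if "i \<le> m" for i
      using t that unfolding face_def by blast
    have "(\<Sum>j<m. t j) = 0"
    proof (intro sum.neutral ballI)
      show "t j = 0" if "j \<in> {..<m}" for j
        using z[of j] that unfolding barycentric_def by simp
    qed
    then show False using z[of m] unfolding barycentric_def by simp
  qed
  then show ?thesis by blast
qed

lemma compact_space_unit_cube: "compact_space (unit_cube m)"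
  unfolding unit_cube_def by (simp add: compact_space_product_topology compact_space_subtopology)

section \<open>The extension theorem\<close>

theorem theorem2p4:
  fixes m :: nat
    and X :: "'a topology" and Y :: "'b topology" and K :: "'c topology"
    and f :: "'a \<Rightarrow> 'b"
  assumes "tychonoff_space X" and "tychonoff_space Y" and "tychonoff_space K"
    and "continuous_map X Y f" and "closed_map X Y f" and "f ` topspace X = topspace Y"
    and "k_space X"
    and "paracompact_space Y" and "covering_dim_le Y m"
    and "absolute_neighborhood_extensor K (prod_topology (unit_cube m) X)"
    and "\<And>y. y \<in> topspace Y \<Longrightarrow>
      e_dim_le (prod_topology (unit_cube m) (subtopology X {x \<in> topspace X. f x = y})) K"
  shows "e_dim_le X K"
  unfolding e_dim_le_def absolute_extensor_def
proof (intro allI impI, elim conjE)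
  fix A g assume A: "closedin X A" and g: "continuous_map (subtopology X A) K g"
  note cont_f = assms(4) and par = assms(8)
  have reg: "regular_space Y" and t1: "t1_space Y"
    using assms(2) completely_regular_imp_regular_space unfolding tychonoff_space_def by auto
  define I where "I = unit_cube m"
  define P where "P = prod_topology I X"
  have topP: "topspace P = topspace I \<times> topspace X" unfolding P_def by simp
  \<comment> \<open>The fibres of \<open>f \<circ> snd\<close> are the products of the cube with the
    fibres of \<open>f\<close>, and this map is closed because the cube is compact. The datum
    \<open>g \<circ> snd\<close> is constant along the cube, so over \<open>A\<close> any choice of
    weights will return \<open>g\<close>.\<close>
  interpret fibrewise_extension P Y K "f \<circ> snd" "topspace I \<times> A" "g \<circ> snd"
    "\<lambda>S. face m S \<times> topspace X" m
  proof
    show "continuous_map P Y (f \<circ> snd)"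
      unfolding P_def using continuous_map_snd cont_f by (rule continuous_map_compose)
    show "closed_map P Y (f \<circ> snd)"
      unfolding P_def I_def
      using closed_map_snd[OF compact_space_unit_cube] assms(5) by (rule closed_map_compose)
    show "absolute_neighborhood_extensor K P"
      using assms(10) unfolding P_def I_def .
    show "absolute_extensor K (subtopology P {z \<in> topspace P. (f \<circ> snd) z = y})"
      if "y \<in> topspace Y" for y
    proof -
      have "{z \<in> topspace P. (f \<circ> snd) z = y} = topspace I \<times> {x \<in> topspace X. f x = y}"
        unfolding topP by auto
      then have "subtopology P {z \<in> topspace P. (f \<circ> snd) z = y} =
          prod_topology I (subtopology X {x \<in> topspace X. f x = y})"
        unfolding P_def prod_topology_subtopology by simp
      then show ?thesis using assms(11)[OF that] unfolding e_dim_le_def I_def by simp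
    qed
    show "closedin P (topspace I \<times> A)"
      unfolding P_def closedin_prod_Times_iff using A by simp
    have "continuous_map (subtopology P (topspace I \<times> A)) (subtopology X A) snd"
      unfolding P_def using continuous_map_snd
      by (auto simp: continuous_map_in_subtopology intro: continuous_map_from_subtopology)
    then show "continuous_map (subtopology P (topspace I \<times> A)) K (g \<circ> snd)"
      using g by (rule continuous_map_compose)
    show "closedin P (face m S \<times> topspace X)" for S
      unfolding P_def I_def closedin_prod_Times_iff using closedin_face by simp
    show "(face m S \<times> topspace X) \<inter> (face m T \<times> topspace X) = face m (S \<inter> T) \<times> topspace X" for S T
      using face_Int by blast
  qed (use par reg t1 face_empty in auto)
  \<comment> \<open>The bound is \<open>Suc m\<close> because the colours \<open>0\<close> to
    \<open>m\<close> allow \<open>m + 1\<close> vertices.\<close>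
  obtain \<W> h where \<W>: "open_cover_of Y \<W>" "locally_finite_in Y \<W>" and h: "coherent (Suc m) \<W> h"
    using coherent_exists by blast
  obtain Q :: "nat \<Rightarrow> 'b set" and w :: "nat \<Rightarrow> 'b \<Rightarrow> 'b set" where
    Q: "\<And>i. openin Y (Q i)" "(\<Union>i\<le>m. Q i) = topspace Y" "\<And>i y. y \<in> Q i \<Longrightarrow> w i y \<in> \<W>"
    "\<And>i y. y \<in> Q i \<Longrightarrow> \<exists>N. openin Y N \<and> y \<in> N \<and> N \<subseteq> Q i \<and> N \<subseteq> w i y \<and> (\<forall>z\<in>N. w i z = w i y)"
    by (rule covering_dim_le_colouring[OF par reg assms(9) \<W>]) blast
  obtain t :: "nat \<Rightarrow> 'b \<Rightarrow> real" where t: "\<And>i. i \<in> {..m} \<Longrightarrow> continuous_map Y euclideanreal (t i)"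
    "\<And>i y. i \<in> {..m} \<Longrightarrow> y \<in> topspace Y \<Longrightarrow> 0 \<le> t i y" "\<And>y. y \<in> topspace Y \<Longrightarrow> (\<Sum>i\<le>m. t i y) = 1"
    "\<And>i y. i \<in> {..m} \<Longrightarrow> y \<in> topspace Y - Q i \<Longrightarrow> \<exists>N. openin Y N \<and> y \<in> N \<and> (\<forall>z\<in>N. t i z = 0)"
    by (rule finite_partition_of_unity[OF par reg finite_atMost[of m] Q(1,2)]) blast
  have fX: "f x \<in> topspace Y" if "x \<in> topspace X" for x
    using assms(6) that by blast
  have t_le: "t i y \<le> 1" if "i \<le> m" "y \<in> topspace Y" for i y
    using member_le_sum[of i "{..m}" "\<lambda>i. t i y"] that t(2,3) by simp
  \<comment> \<open>\<open>s\<close> lifts \<open>X\<close> into the product: over \<open>x\<close>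
    it picks the point with barycentric coordinates \<open>t i (f x)\<close>. The coordinate of
    colour \<open>m\<close> belongs to the origin and stays implicit.\<close>
  define s where "s = (\<lambda>x. (restrict (\<lambda>i. t i (f x)) {..<m}, x))"
  have "continuous_map X (top_of_set {0..1}) (\<lambda>x. t i (f x))" if "i < m" for i
    using continuous_map_compose[OF cont_f t(1)[of i]] that fX t(2) t_le
    by (auto simp: continuous_map_in_subtopology o_def)
  then have cont_s: "continuous_map X P s"
    unfolding s_def P_def I_def unit_cube_def
    by (intro continuous_map_pairedI) (auto simp: continuous_map_componentwise)
  have bary: "barycentric m i (fst (s x)) = t i (f x)" if "i \<le> m" "x \<in> topspace X" for i x
  proof (cases "i < m")
    case False
    then have "i = m" using that by simp
    moreover have "(\<Sum>i<m. t i (f x)) + t m (f x) = 1"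
      using t(3)[OF fX[OF that(2)]] by (simp add: lessThan_Suc_atMost[symmetric])
    ultimately show ?thesis unfolding barycentric_def s_def by simp
  qed (simp add: barycentric_def s_def)
  \<comment> \<open>The simplex over \<open>y\<close> uses every colour whose set contains
    \<open>y\<close>, even one of weight zero. As the \<open>Q i\<close> are open, \<open>J\<close>
    can only grow near \<open>y\<close>.\<close>
  define J where "J = (\<lambda>y. {i. i \<le> m \<and> y \<in> Q i})"
  define H where "H = (\<lambda>x. h (J (f x)) (\<lambda>i. w i (f x)) (s x))"
  have w_mem: "y \<in> w i y" if "y \<in> Q i" for i y
    using Q(4)[OF that] by blast
  have simplex: "(J y, \<lambda>i. w i y) \<in> simplices (Suc m) \<W>" if y: "y \<in> topspace Y" for y
  proof -
    have "J y \<subseteq> {..m}" unfolding J_def by blast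
    moreover from card_mono[OF _ this] have "card (J y) \<le> Suc m" by simp
    moreover have "J y \<noteq> {}" using y Q(2) unfolding J_def by blast
    moreover have "y \<in> (\<Inter>i\<in>J y. w i y)" unfolding J_def using w_mem by blast
    ultimately show ?thesis
      unfolding simplices_def using Q(3) unfolding J_def by auto
  qed
  have mem: "y \<in> (\<Inter>i\<in>J y. w i y)" for y
    unfolding J_def using w_mem by blast
  \<comment> \<open>Near \<open>y\<close> the colours of \<open>J y\<close> keep their labels, and
    colours that newly appear have weight zero; so \<open>s\<close> stays in the face of
    \<open>J y\<close>.\<close>
  have "\<exists>N. openin Y N \<and> y \<in> N \<and> (\<forall>i\<in>J y. N \<subseteq> Q i \<and> N \<subseteq> w i y \<and> (\<forall>z\<in>N. w i z = w i y)) \<and>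
      (\<forall>i\<in>{..m} - J y. \<forall>z\<in>N. t i z = 0)" if y: "y \<in> topspace Y" for y
  proof -
    have "\<forall>i\<in>{..m}. \<exists>N. openin Y N \<and> y \<in> N \<and>
        (i \<in> J y \<longrightarrow> N \<subseteq> Q i \<and> N \<subseteq> w i y \<and> (\<forall>z\<in>N. w i z = w i y)) \<and>
        (i \<notin> J y \<longrightarrow> (\<forall>z\<in>N. t i z = 0))"
    proof
      fix i assume "i \<in> {..m}"
      then show "\<exists>N. openin Y N \<and> y \<in> N \<and>
        (i \<in> J y \<longrightarrow> N \<subseteq> Q i \<and> N \<subseteq> w i y \<and> (\<forall>z\<in>N. w i z = w i y)) \<and>
        (i \<notin> J y \<longrightarrow> (\<forall>z\<in>N. t i z = 0))"
        using Q(4)[of y i] t(4)[of i y] y unfolding J_def by (cases "y \<in> Q i") auto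
    qed
    then obtain N where N: "\<And>i. i \<in> {..m} \<Longrightarrow> openin Y (N i) \<and> y \<in> N i \<and>
        (i \<in> J y \<longrightarrow> N i \<subseteq> Q i \<and> N i \<subseteq> w i y \<and> (\<forall>z\<in>N i. w i z = w i y)) \<and>
        (i \<notin> J y \<longrightarrow> (\<forall>z\<in>N i. t i z = 0))"
      by metis
    define L where "L = (\<Inter>i\<le>m. N i)"
    have LN: "L \<subseteq> N i" if "i \<in> {..m}" for i unfolding L_def using that by blast
    have near: "L \<subseteq> Q i \<and> L \<subseteq> w i y \<and> (\<forall>z\<in>L. w i z = w i y)" if "i \<in> J y" for i
    proof -
      have "i \<in> {..m}" using that unfolding J_def by simp
      then show ?thesis using N[of i] LN[of i] that by blast
    qed
    have zero: "\<forall>z\<in>L. t i z = 0" if "i \<in> {..m} - J y" for i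
      using N[of i] LN[of i] that by blast
    show ?thesis
    proof (rule exI[of _ L], intro conjI)
      show "openin Y L" unfolding L_def using N by (intro openin_INT2) auto
      show "y \<in> L" unfolding L_def using N by blast
    qed (use near zero in simp_all)
  qed
  then obtain N where N: "\<And>y. y \<in> topspace Y \<Longrightarrow> openin Y (N y) \<and> y \<in> N y \<and>
      (\<forall>i\<in>J y. N y \<subseteq> Q i \<and> N y \<subseteq> w i y \<and> (\<forall>z\<in>N y. w i z = w i y)) \<and>
      (\<forall>i\<in>{..m} - J y. \<forall>z\<in>N y. t i z = 0)"
    by metis
  define T where "T = (\<lambda>y. {x \<in> topspace X. f x \<in> N y})"
  have H_eq: "H x = h (J y) (\<lambda>i. w i y) (s x)" if y: "y \<in> topspace Y" and x: "x \<in> T y" for x y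
  proof -
    have xX: "x \<in> topspace X" and fN: "f x \<in> N y" using x unfolding T_def by auto
    have sX: "s x \<in> face m (J y) \<times> topspace X"
    proof -
      have "s x \<in> topspace P" using cont_s xX unfolding continuous_map_def by blast
      then show ?thesis
        using bary[OF _ xX] N[OF y] fN unfolding face_def topP I_def
        by (auto simp: mem_Times_iff)
    qed
    \<comment> \<open>The simplex over \<open>f x\<close> may be larger than that over
      \<open>y\<close>, but coherence lets it be replaced by its face \<open>J y\<close>. Thus
      \<open>H\<close> is given near \<open>y\<close> by one fixed continuous map.\<close>
    have "h (J y) (\<lambda>i. w i y) (s x) = h (J (f x)) (\<lambda>i. w i (f x)) (s x)"
    proof (rule coherentD(3)[OF h simplex[OF fX[OF xX]] _ _ _ sX])
      show "J y \<subseteq> J (f x)" using N[OF y] fN unfolding J_def by blast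
      show "J y \<noteq> {}" using y Q(2) unfolding J_def by blast
      show "w i y = w i (f x)" if "i \<in> J y" for i using N[OF y] fN that by metis
      show "(f \<circ> snd) (s x) \<in> (\<Inter>i\<in>J (f x). w i (f x))"
        using mem unfolding s_def by simp
    qed
    then show ?thesis unfolding H_def by simp
  qed
  have "continuous_map X K H"
  proof (rule pasting_lemma[of "topspace Y" X T K "\<lambda>y x. h (J y) (\<lambda>i. w i y) (s x)"])
    show "openin X (T y)" if "y \<in> topspace Y" for y
      unfolding T_def using openin_continuous_map_preimage[OF cont_f] N[OF that] by blast
    show "continuous_map (subtopology X (T y)) K (\<lambda>x. h (J y) (\<lambda>i. w i y) (s x))"
      if y: "y \<in> topspace Y" for y
    proof -
      have "N y \<subseteq> (\<Inter>i\<in>J y. w i y)" using N[OF y] by blast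
      then have "s x \<in> over (\<Inter>i\<in>J y. w i y)" if "x \<in> T y" for x
        using that cont_s unfolding T_def over_def continuous_map_def s_def by auto
      then have "continuous_map (subtopology X (T y)) (subtopology P (over (\<Inter>i\<in>J y. w i y))) s"
        using cont_s by (auto simp: continuous_map_in_subtopology intro: continuous_map_from_subtopology)
      from continuous_map_compose[OF this coherentD(1)[OF h simplex[OF y]]]
      show ?thesis by (simp add: o_def)
    qed
    show "\<exists>y. y \<in> topspace Y \<and> x \<in> T y \<and> H x = h (J y) (\<lambda>i. w i y) (s x)" if "x \<in> topspace X" for x
      using that fX[OF that] N[OF fX[OF that]] unfolding H_def T_def by blast
  qed (use H_eq in \<open>metis Int_iff\<close>)
  moreover have "H x = g x" if x: "x \<in> A" for x
  proof -
    have xX: "x \<in> topspace X" using x A closedin_subset by blast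
    have "s x \<in> topspace P" using cont_s xX unfolding continuous_map_def by blast
    then have "s x \<in> topspace I \<times> A"
      using x unfolding topP by (auto simp: s_def)
    then have "H x = (g \<circ> snd) (s x)"
      unfolding H_def using coherentD(2)[OF h simplex[OF fX[OF xX]]] mem[of "f x"]
      by (simp add: s_def)
    then show ?thesis by (simp add: s_def)
  qed
  ultimately show "\<exists>h. continuous_map X K h \<and> (\<forall>x\<in>A. h x = g x)" by blast
qed

end
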